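(* Let $d\ge2$, $1\le m<d$, $\delta\in(0,1)$. Let $f=(f_1,\dots,f_L):\mathbb{R}^d\to\mathbb{R}^L$ be a classifier with continuous components whose pairwise decision boundaries are smooth hypersurfaces, fix $\boldsymbol{x}_0\in\mathbb{R}^d$ with $f_{\hat k}(\boldsymbol{x}_0)>f_k(\boldsymbol{x}_0)$ for all $k\ne\hat k$, and fix a class $k\neq\hat k$ with $\|\boldsymbol{r}^k\|_2<\infty$. Let $\kappa:=\kappa(\mathscr{B}_k)$ and assume $$\kappa\le\frac{C}{\zeta_2(m,\delta)\,\|\boldsymbol{r}^k\|_2}\,\frac{m}{d}.$$ Let $\mathcal{S}$ be a random $m$-dimensional subspace of $\mathbb{R}^d$. Then, with probability at least $1-4\delta$, $$\Big(1-C_1\|\boldsymbol{r}^k\|_2\,\kappa\,\zeta_2(m,\delta)\tfrac{d}{m}\Big)\sqrt{\zeta_1(m,\delta)}\sqrt{\tfrac dm}\;\le\;\frac{\|\boldsymbol{r}^k_{\mathcal S}\|_2}{\|\boldsymbol{r}^k\|_2}\;\le\;\Big(1+C_2\|\boldsymbol{r}^k\|_2\,\kappa\,\zeta_2(m,\delta)\tfrac{d}{m}\Big)\sqrt{\zeta_2(m,\delta)}\sqrt{\tfrac dm},$$ where $C=0.2$, $C_1=0.625$, $C_2=2.25$.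
   Context: For an $L$-class classifier $f=(f_1,\dots,f_L):\mathbb{R}^d\to\mathbb{R}^L$ and a point $\boldsymbol{x}_0$ with estimated label $\hat k=\arg\max_k f_k(\boldsymbol{x}_0)$, and for a linear subspace $\mathcal{S}\subseteq\mathbb{R}^d$ and $k\neq\hat k$, define $\|\boldsymbol{r}^k_{\mathcal S}\|_2=\inf\{\|\boldsymbol{r}\|_2:\boldsymbol{r}\in\mathcal{S},\ f_k(\boldsymbol{x}_0+\boldsymbol{r})\ge f_{\hat k}(\boldsymbol{x}_0+\boldsymbol{r})\}$ (with $\inf\emptyset=+\infty$) and $\|\boldsymbol{r}^k\|_2:=\|\boldsymbol{r}^k_{\mathbb{R}^d}\|_2$. A random $m$-dimensional subspace of $\mathbb{R}^d$ is the span of $m$ independent vectors drawn uniformly from the unit sphere $\mathbb{S}^{d-1}$. For $m\ge1$ and $\delta\in(0,1)$, $\zeta_1(m,\delta)=\Big(1+2\sqrt{\tfrac{\ln(1/\delta)}{m}}+\tfrac{2\ln(1/\delta)}{m}\Big)^{-1}$ and $\zeta_2(m,\delta)=\Big(\max\big(\tfrac1e\delta^{2/m},\,1-\sqrt{2(1-\delta^{2/m})}\big)\Big)^{-1}$. Curvature: for classes $i\ne j$, let $\mathscr{B}_{i,j}=\{\boldsymbol{x}:f_i(\boldsymbol{x})-f_j(\boldsymbol{x})=0\}$, $\mathcal{R}_i=\{\boldsymbol{x}:f_i(\boldsymbol{x})>f_j(\boldsymbol{x})\}$, $\mathcal{R}_j=\{\boldsymbol{x}:f_j(\boldsymbol{x})>f_i(\boldsymbol{x})\}$.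 For $\boldsymbol{p}\in\mathscr{B}_{i,j}$ let $q_{i\|j}(\boldsymbol{p})=\sup\{\|\boldsymbol{z}-\boldsymbol{p}\|_2:\boldsymbol{z}\in\mathbb{R}^d,\ \mathbb{B}(\boldsymbol{z},\|\boldsymbol{z}-\boldsymbol{p}\|_2)\subseteq\mathcal{R}_i\}$, where $\mathbb{B}(\boldsymbol{z},\rho)$ is the open Euclidean ball of center $\boldsymbol{z}$ and radius $\rho$ (the radius of the largest open ball contained in $\mathcal{R}_i$ whose boundary passes through $\boldsymbol{p}$). Let $q_{i,j}(\boldsymbol{p})=\min(q_{i\|j}(\boldsymbol{p}),q_{j\|i}(\boldsymbol{p}))$, $q(\mathscr{B}_{i,j})=\inf_{\boldsymbol{p}\in\mathscr{B}_{i,j}}q_{i,j}(\boldsymbol{p})$ and $\kappa(\mathscr{B}_{i,j})=1/q(\mathscr{B}_{i,j})$ (with $1/\infty=0$). Write $\mathscr{B}_k:=\mathscr{B}_{k,\hat k}$. *)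

theory Defs
  imports "HOL-Analysis.Analysis" "HOL-Probability.Probability"
begin

fun pderivs :: "('a::euclidean_space \<Rightarrow> real) \<Rightarrow> 'a list \<Rightarrow> 'a \<Rightarrow> real" where
  "pderivs g [] = g"
| "pderivs g (b # bs) = (\<lambda>x. deriv (\<lambda>t. pderivs g bs (x + t *\<^sub>R b)) 0)"

definition smooth_on_set :: "'a::euclidean_space set \<Rightarrow> ('a \<Rightarrow> real) \<Rightarrow> bool" where
  "smooth_on_set U g \<longleftrightarrow> open U \<and>
     (\<forall>bs. set bs \<subseteq> Basis \<longrightarrow>
        continuous_on U (pderivs g bs) \<and>
        (\<forall>x\<in>U. \<forall>b\<in>Basis. (\<lambda>t. pderivs g bs (x + t *\<^sub>R b)) differentiable (at 0)))"

definition smooth_hypersurface :: "'a::euclidean_space set \<Rightarrow> bool" where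
  "smooth_hypersurface B \<longleftrightarrow>
     (\<forall>p\<in>B. \<exists>U g. p \<in> U \<and> smooth_on_set U g \<and> (\<exists>b\<in>Basis. pderivs g [b] p \<noteq> 0) \<and>
        B \<inter> U = {x\<in>U. g x = 0})"

definition dboundary :: "(nat \<Rightarrow> 'a \<Rightarrow> real) \<Rightarrow> nat \<Rightarrow> nat \<Rightarrow> 'a set" where
  "dboundary f i j = {x. f i x - f j x = 0}"

definition region :: "(nat \<Rightarrow> 'a \<Rightarrow> real) \<Rightarrow> nat \<Rightarrow> nat \<Rightarrow> 'a set" where
  "region f i j = {x. f i x > f j x}"

text \<open>Minimal perturbation norm within subspace S: inf over r in S with f_k(x0+r) >= f_khat(x0+r);
  inf of the empty set is +infinity.\<close>
definition advnorm :: "(nat \<Rightarrow> 'a::real_normed_vector \<Rightarrow> real) \<Rightarrow> nat \<Rightarrow> nat \<Rightarrow> 'a \<Rightarrow> 'a set \<Rightarrow> ereal" where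
  "advnorm f khat k x0 S = Inf {ereal (norm r) | r. r \<in> S \<and> f k (x0 + r) \<ge> f khat (x0 + r)}"

definition q_dir :: "(nat \<Rightarrow> 'a::real_normed_vector \<Rightarrow> real) \<Rightarrow> nat \<Rightarrow> nat \<Rightarrow> 'a \<Rightarrow> ereal" where
  "q_dir f i j p = Sup {ereal (norm (z - p)) | z. ball z (norm (z - p)) \<subseteq> region f i j}"

definition q_pt :: "(nat \<Rightarrow> 'a::real_normed_vector \<Rightarrow> real) \<Rightarrow> nat \<Rightarrow> nat \<Rightarrow> 'a \<Rightarrow> ereal" where
  "q_pt f i j p = min (q_dir f i j p) (q_dir f j i p)"

definition q_bd :: "(nat \<Rightarrow> 'a::real_normed_vector \<Rightarrow> real) \<Rightarrow> nat \<Rightarrow> nat \<Rightarrow> ereal" where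
  "q_bd f i j = Inf (q_pt f i j ` dboundary f i j)"

text \<open>Curvature kappa = 1/q, with 1/infinity = 0 (and 1/0 = infinity).\<close>
definition curv :: "(nat \<Rightarrow> 'a::real_normed_vector \<Rightarrow> real) \<Rightarrow> nat \<Rightarrow> nat \<Rightarrow> ereal" where
  "curv f i j = inverse (q_bd f i j)"

definition zeta1 :: "nat \<Rightarrow> real \<Rightarrow> real" where
  "zeta1 m \<delta> = inverse (1 + 2 * sqrt (ln (1/\<delta>) / real m) + 2 * ln (1/\<delta>) / real m)"

definition zeta2 :: "nat \<Rightarrow> real \<Rightarrow> real" where
  "zeta2 m \<delta> = inverse (max (exp (-1) * \<delta> powr (2 / real m))
                              (1 - sqrt (2 * (1 - \<delta> powr (2 / real m)))))"

text \<open>Uniform (normalized surface) measure on the unit sphere, realised as the cone measure: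
  push-forward of the normalized Lebesgue measure on the unit ball under x / |x|.\<close>
definition unif_sphere :: "'a::euclidean_space measure" where
  "unif_sphere = distr (uniform_measure lborel (ball 0 1)) borel (\<lambda>x. x /\<^sub>R norm x)"

text \<open>m independent uniform vectors on the sphere; the random subspace is their span.\<close>
definition rand_vectors :: "nat \<Rightarrow> (nat \<Rightarrow> 'a::euclidean_space) measure" where
  "rand_vectors m = PiM {..<m} (\<lambda>_. unif_sphere)"

end

theory Submission
  imports Defs
begin

text \<open>
  Let \<open>n\<close> be the direction of the minimal perturbation \<open>r\<close> and \<open>s\<close> the cosine of its angle with the random
  subspace \<open>S\<close>. Minimality forces the two balls of radius \<open>1 / \<kappa>\<close> that touch the boundary at \<open>x0 + r\<close> to have
  their centres on the line through \<open>x0\<close>, so perturbations in \<open>S\<close> have to leave one ball and may stop inside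
  the other; elementary estimates turn this into bounds by \<open>norm r / s\<close> up to the curvature terms.

  For the concentration of \<open>s\<close>, rotation invariance allows one to average over \<open>n\<close> in the unit ball \<open>B\<close>
  with \<open>S\<close> fixed. The linear map \<open>T\<close> scaling \<open>S\<close> by \<open>sqrt a\<close> and its orthogonal complement by \<open>sqrt b\<close>,
  where \<open>a t + b (1 - t) = 1\<close>, maps the part of \<open>B\<close> in the cone \<open>s ^ 2 \<ge> t\<close> (if \<open>a \<le> b\<close>) or
  \<open>s ^ 2 \<le> t\<close> (if \<open>a \<ge> b\<close>) into \<open>B\<close>, so this part has relative volume at most \<open>1 / det T\<close>. With \<open>t = \<tau> m / d\<close>
  and the best \<open>a\<close>, \<open>b\<close> this is at most \<open>exp (- m / 2 * (\<tau> - 1 - ln \<tau>))\<close>, which is at most \<open>\<delta>\<close> for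
  \<open>\<tau> = 1 / \<zeta>\<^sub>1\<close> and \<open>\<tau> = 1 / \<zeta>\<^sub>2\<close>.
\<close>

section \<open>Orthogonal transformations and Lebesgue measure\<close>

lemma subspace_orthogonal_projection:
  fixes S :: "'a::euclidean_space set"
  assumes "subspace S"
  obtains P where "linear P" "\<And>x. P x \<in> S" "\<And>x y. y \<in> S \<Longrightarrow> (x - P x) \<bullet> y = 0"
proof -
  obtain B where B: "B \<subseteq> S" "pairwise orthogonal B" "\<And>x. x \<in> B \<Longrightarrow> norm x = 1"
    "independent B" "span B = S"
    by (metis orthonormal_basis_subspace[OF assms])
  have fin: "finite B"
    using B(4) by (rule independent_imp_finite)
  define P where "P x = (\<Sum>b\<in>B. (x \<bullet> b) *\<^sub>R b)" for x
  have lin: "linear P"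
    unfolding P_def by (rule linearI) (simp_all add: inner_add_left sum.distrib scaleR_add_left scaleR_sum_right)
  have PS: "P x \<in> S" for x
    unfolding P_def using B(1) assms by (intro subspace_sum subspace_scale) auto
  have "(x - P x) \<bullet> c = 0" if "c \<in> B" for x c
  proof -
    have "P x \<bullet> c = (\<Sum>b\<in>B. (x \<bullet> b) * (b \<bullet> c))"
      by (simp add: P_def inner_sum_left)
    also have "\<dots> = (\<Sum>b\<in>B. if b = c then x \<bullet> c else 0)"
      using B(2,3) that by (intro sum.cong refl) (auto simp: pairwise_def orthogonal_def norm_eq_1)
    also have "\<dots> = x \<bullet> c"
      using fin that by simp
    finally show ?thesis
      by (simp add: inner_diff_left)
  qed
  then have "(x - P x) \<bullet> y = 0" if "y \<in> S" for x y
    using that B(5) orthogonal_to_span[of y B "x - P x"] by (auto simp: orthogonal_def inner_commute)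
  then show ?thesis
    using that lin PS by blast
qed

text \<open>Pythagoras. Later events are phrased through \<open>infdist\<close> instead of a chosen
  projection: for a unit vector the squared cosine of its angle with \<open>S\<close> is
  \<open>1 - (infdist x S) ^ 2\<close>, and this form is easy to rotate and to measure.\<close>

lemma infdist_subspace_eq_norm:
  fixes S :: "'a::euclidean_space set"
  assumes "y \<in> S" "\<And>w. w \<in> S \<Longrightarrow> (x - y) \<bullet> w = 0" "subspace S"
  shows "infdist x S = norm (x - y)"
proof (rule antisym)
  show "infdist x S \<le> norm (x - y)"
    using infdist_le[OF assms(1), of x] by (simp add: dist_norm)
  have "norm (x - y) \<le> dist x w" if "w \<in> S" for w
  proof -
    have "(x - y) \<bullet> (y - w) = 0"
      using assms that by (simp add: subspace_diff)
    then have "(norm (x - w))\<^sup>2 = (norm (x - y))\<^sup>2 + (norm (y - w))\<^sup>2"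
      using norm_add_Pythagorean[of "x - y" "y - w"] by (simp add: orthogonal_def)
    then show ?thesis
      unfolding dist_norm by (simp add: power2_le_imp_le)
  qed
  moreover have "S \<noteq> {}"
    using assms(1) by blast
  ultimately show "norm (x - y) \<le> infdist x S"
    unfolding infdist_notempty[OF \<open>S \<noteq> {}\<close>] by (intro cINF_greatest)
qed

lemma orthogonal_transformation_infdist:
  assumes "orthogonal_transformation Q"
  shows "infdist (Q x) (Q ` S) = infdist x S"
proof -
  have "dist (Q x) (Q y) = dist x y" for x y
    using assms by (metis dist_norm linear_diff orthogonal_transformation)
  then show ?thesis
    by (simp add: infdist_def image_image)
qed

text \<open>Linear isometries exist between \<open>S\<close> and \<open>T\<close> and between their
  orthogonal complements, since the dimensions agree; the projection onto \<open>S\<close> glues the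
  two into one orthogonal map.\<close>

lemma orthogonal_transformation_between_subspaces:
  fixes S T :: "'a::euclidean_space set"
  assumes S: "subspace S" and T: "subspace T" and dim: "dim S = dim T"
  obtains Q where "orthogonal_transformation Q" "Q ` S = T"
proof -
  define S' where "S' = {y \<in> UNIV. \<forall>x\<in>S. orthogonal x y}"
  define T' where "T' = {y \<in> UNIV. \<forall>x\<in>T. orthogonal x y}"
  have "subspace S'" "subspace T'"
    by (simp_all add: S'_def T'_def subspace_orthogonal_to_vectors)
  moreover have "dim S' + dim S = DIM('a)" "dim T' + dim T = DIM('a)"
    using dim_subspace_orthogonal_to_vectors[OF S subspace_UNIV]
      dim_subspace_orthogonal_to_vectors[OF T subspace_UNIV]
    by (simp_all add: S'_def T'_def)
  ultimately obtain g where g: "linear g" "g ` S' = T'" "\<And>x. x \<in> S' \<Longrightarrow> norm (g x) = norm x"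
    using dim by (metis isometries_subspaces add_right_cancel)
  obtain f where f: "linear f" "f ` S = T" "\<And>x. x \<in> S \<Longrightarrow> norm (f x) = norm x"
    using S T dim by (metis isometries_subspaces)
  obtain P where P: "linear P" "\<And>x. P x \<in> S" "\<And>x y. y \<in> S \<Longrightarrow> (x - P x) \<bullet> y = 0"
    using subspace_orthogonal_projection[OF S] by metis
  have P': "x - P x \<in> S'" for x
    using P(3) by (simp add: S'_def orthogonal_def inner_commute)
  define Q where "Q x = f (P x) + g (x - P x)" for x
  have "linear Q"
    unfolding Q_def using linear_compose[OF P(1) f(1)]
      linear_compose[OF linear_compose_sub[OF linear_ident P(1)] g(1)]
    by (simp add: linear_compose_add o_def)
  moreover have "norm (Q x) = norm x" for x
  proof -
    have "orthogonal (f (P x)) (g (x - P x))"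
      using f(2) g(2) P(2) P' by (fastforce simp: T'_def)
    then have "(norm (Q x))\<^sup>2 = (norm (P x))\<^sup>2 + (norm (x - P x))\<^sup>2"
      by (simp add: Q_def norm_add_Pythagorean f(3) g(3) P(2) P')
    also have "\<dots> = (norm x)\<^sup>2"
      using norm_add_Pythagorean[of "P x" "x - P x"] P(2) P(3)
      by (simp add: orthogonal_def inner_commute)
    finally show ?thesis
      by simp
  qed
  ultimately have Q: "orthogonal_transformation Q"
    by (simp add: orthogonal_transformation)
  have "Q x = f x" if "x \<in> S" for x
  proof -
    have "(x - P x) \<bullet> (x - P x) = 0"
      using P that S by (simp add: subspace_diff)
    then have "P x = x" by simp
    then show ?thesis
      using g(1) by (simp add: Q_def linear_0)
  qed
  then have "Q ` S = T"
    using f(2) by (auto simp: image_iff)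
  with Q that show ?thesis by blast
qed

text \<open>Translation invariance alone determines Lebesgue measure up to a factor: by Fubini
  \<open>\<integral>\<integral> 1\<^sub>A(x) 1\<^sub>B(y - x) dx d\<nu>(y)\<close> equals both \<open>\<lambda>(A) \<nu>(B)\<close> and \<open>\<nu>(A) \<lambda>(B)\<close>.\<close>

lemma translation_invariant_emeasure_swap:
  fixes \<nu> :: "'a::euclidean_space measure"
  assumes "sigma_finite_measure \<nu>" and sets[measurable_cong]: "sets \<nu> = sets borel"
    and inv: "\<And>c. distr \<nu> borel ((+) c) = \<nu>"
    and [measurable]: "A \<in> sets borel" "B \<in> sets borel"
  shows "emeasure lborel A * emeasure \<nu> B = emeasure lborel B * emeasure \<nu> A"
proof -
  interpret N: sigma_finite_measure \<nu> by fact
  interpret P: pair_sigma_finite lborel \<nu>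
    by unfold_locales
  have space: "space \<nu> = UNIV"
    using sets_eq_imp_space_eq[OF sets] by simp
  have shift: "(\<integral>\<^sup>+y. g (c + y) \<partial>\<nu>) = (\<integral>\<^sup>+y. g y \<partial>\<nu>)" if [measurable]: "g \<in> borel_measurable borel" for g c
    by (subst (2) inv[of c, symmetric]) (simp add: nn_integral_distr)
  have refl: "(\<integral>\<^sup>+x. g (c - x) \<partial>lborel) = (\<integral>\<^sup>+x. g x \<partial>lborel)" if [measurable]: "g \<in> borel_measurable borel" for g and c :: 'a
  proof -
    have "lborel = distr lborel borel (\<lambda>x. c - x)"
      using lborel_affine[of "-1" c] by (simp add: density_1)
    then have "(\<integral>\<^sup>+x. g x \<partial>lborel) = (\<integral>\<^sup>+x. g x \<partial>distr lborel borel (\<lambda>x. c - x))"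
      by simp
    then show ?thesis
      by (simp add: nn_integral_distr)
  qed
  have "emeasure lborel A * emeasure \<nu> B = (\<integral>\<^sup>+x. indicator A x * emeasure \<nu> B \<partial>lborel)"
    by (simp add: nn_integral_multc)
  also have "\<dots> = (\<integral>\<^sup>+x. \<integral>\<^sup>+y. indicator A x * indicator B (y - x) \<partial>\<nu> \<partial>lborel)"
  proof (rule nn_integral_cong)
    fix x :: 'a
    have "emeasure \<nu> B = (\<integral>\<^sup>+y. indicator B y \<partial>\<nu>)"
      by simp
    also have "\<dots> = (\<integral>\<^sup>+y. indicator B (y - x) \<partial>\<nu>)"
      using shift[of "indicator B" "- x"] by simp
    finally show "indicator A x * emeasure \<nu> B = (\<integral>\<^sup>+y. indicator A x * indicator B (y - x) \<partial>\<nu>)"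
      by (simp add: nn_integral_cmult)
  qed
  also have "\<dots> = (\<integral>\<^sup>+y. \<integral>\<^sup>+x. indicator A x * indicator B (y - x) \<partial>lborel \<partial>\<nu>)"
    by (rule P.Fubini'[symmetric]) measurable
  \<comment> \<open>The reflection \<open>x\<close> to \<open>y - x\<close> preserves Lebesgue
    measure and exchanges the roles of \<open>A\<close> and \<open>B\<close>, so the same
    computation can be run backwards.\<close>
  also have "\<dots> = (\<integral>\<^sup>+y. \<integral>\<^sup>+x. indicator A (y - x) * indicator B x \<partial>lborel \<partial>\<nu>)"
  proof (rule nn_integral_cong)
    fix y :: 'a
    show "(\<integral>\<^sup>+x. indicator A x * indicator B (y - x) \<partial>lborel) = (\<integral>\<^sup>+x. indicator A (y - x) * indicator B x \<partial>lborel)"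
      using refl[of "\<lambda>x. indicator A x * indicator B (y - x)" y] by simp
  qed
  also have "\<dots> = (\<integral>\<^sup>+x. \<integral>\<^sup>+y. indicator A (y - x) * indicator B x \<partial>\<nu> \<partial>lborel)"
    by (rule P.Fubini') measurable
  also have "\<dots> = (\<integral>\<^sup>+x. indicator B x * emeasure \<nu> A \<partial>lborel)"
  proof (rule nn_integral_cong)
    fix x :: 'a
    have "emeasure \<nu> A = (\<integral>\<^sup>+y. indicator A y \<partial>\<nu>)"
      by simp
    also have "\<dots> = (\<integral>\<^sup>+y. indicator A (y - x) \<partial>\<nu>)"
      using shift[of "indicator A" "- x"] by simp
    finally show "(\<integral>\<^sup>+y. indicator A (y - x) * indicator B x \<partial>\<nu>) = indicator B x * emeasure \<nu> A"
      by (simp add: nn_integral_cmult mult.commute)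
  qed
  also have "\<dots> = emeasure lborel B * emeasure \<nu> A"
    by (simp add: nn_integral_multc)
  finally show ?thesis .
qed

lemma orthogonal_transformation_measurable:
  fixes Q :: "'a::euclidean_space \<Rightarrow> 'a"
  shows "orthogonal_transformation Q \<Longrightarrow> Q \<in> borel_measurable borel"
  by (intro borel_measurable_continuous_onI linear_continuous_on)
    (simp add: linear_conv_bounded_linear[symmetric] orthogonal_transformation_linear)

lemma orthogonal_transformation_vimage_ball:
  assumes "orthogonal_transformation Q"
  shows "Q -` ball 0 r = ball 0 r"
proof -
  have "norm (Q x) = norm x" for x
    using assms by (rule orthogonal_transformation_norm)
  then show ?thesis
    by auto
qed

lemma emeasure_lborel_unit_ball:
  "emeasure lborel (ball 0 1 :: 'a::euclidean_space set) \<noteq> \<infinity>"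
  "emeasure lborel (ball 0 1 :: 'a set) \<noteq> 0"
proof -
  show "emeasure lborel (ball 0 1 :: 'a::euclidean_space set) \<noteq> \<infinity>"
    using emeasure_lborel_ball_finite[of "0::'a" 1] by simp
  show "emeasure lborel (ball 0 1 :: 'a set) \<noteq> 0"
  proof
    assume "emeasure lborel (ball 0 1 :: 'a set) = 0"
    then have "measure lborel (ball 0 1 :: 'a set) = 0"
      by (simp add: measure_def)
    with content_ball_pos[of 1 "0::'a"] show False
      by simp
  qed
qed

text \<open>The image measure is again translation invariant, because a shift by \<open>c\<close>
  after \<open>Q\<close> is a shift by a preimage of \<open>c\<close> before \<open>Q\<close>. So it
  is a multiple of Lebesgue measure, and the factor is 1 since \<open>Q\<close> preserves the unit
  ball.\<close>

lemma distr_lborel_orthogonal_transformation: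
  fixes Q :: "'a::euclidean_space \<Rightarrow> 'a"
  assumes Q: "orthogonal_transformation Q"
  shows "distr lborel borel Q = lborel"
proof (rule measure_eqI)
  note [measurable] = orthogonal_transformation_measurable[OF Q]
  let ?\<nu> = "distr lborel borel Q"
  have ball: "emeasure ?\<nu> (ball 0 r) = emeasure lborel (ball 0 r :: 'a set)" for r
    by (simp add: emeasure_distr orthogonal_transformation_vimage_ball[OF Q])
  have sf: "sigma_finite_measure ?\<nu>"
  proof
    show "\<exists>A. countable A \<and> A \<subseteq> sets ?\<nu> \<and> \<Union> A = space ?\<nu> \<and> (\<forall>a\<in>A. emeasure ?\<nu> a \<noteq> \<infinity>)"
    proof (intro exI[of _ "range (\<lambda>n::nat. ball 0 (real n))"] conjI ballI)
      show "\<Union> (range (\<lambda>n::nat. ball 0 (real n))) = space ?\<nu>"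
        using reals_Archimedean2 by auto
      fix a :: "'a set" assume "a \<in> range (\<lambda>n. ball 0 (real n))"
      then show "emeasure ?\<nu> a \<noteq> \<infinity>"
        using emeasure_lborel_ball_finite[of "0::'a"] by (auto simp: ball less_top[symmetric])
    qed auto
  qed
  have inv: "distr ?\<nu> borel ((+) c) = ?\<nu>" for c
  proof -
    obtain e where e: "Q e = c"
      using orthogonal_transformation_surj[OF Q] by (metis surjD)
    have "(+) c \<circ> Q = Q \<circ> (+) e"
      using Q e by (auto simp: orthogonal_transformation_linear linear_add)
    then have "distr ?\<nu> borel ((+) c) = distr (distr lborel borel ((+) e)) borel Q"
      by (simp add: distr_distr)
    then show ?thesis
      by (simp add: lborel_distr_plus)
  qed
  fix A assume "A \<in> sets ?\<nu>"
  then have "emeasure lborel A * emeasure ?\<nu> (ball 0 1) = emeasure lborel (ball 0 1 :: 'a set) * emeasure ?\<nu> A"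
    by (intro translation_invariant_emeasure_swap[OF sf _ inv]) auto
  then have "emeasure lborel (ball 0 1 :: 'a set) * emeasure lborel A = emeasure lborel (ball 0 1 :: 'a set) * emeasure ?\<nu> A"
    by (simp only: ball mult.commute)
  then show "emeasure ?\<nu> A = emeasure lborel A"
    using emeasure_lborel_unit_ball[where 'a='a]
    by (simp only: ennreal_mult_cancel_left infinity_ennreal_def) simp
qed simp

section \<open>Volumes of cones around a subspace\<close>

text \<open>The set lies in the preimage of the unit ball under the diagonal map with entries
  \<open>c j\<close>, and that preimage has the volume of the ball divided by the
  determinant.\<close>

lemma emeasure_lborel_diagonal_contraction:
  fixes c :: "'a::euclidean_space \<Rightarrow> real"
  assumes c: "\<And>j. j \<in> Basis \<Longrightarrow> c j > 0"
  shows "emeasure lborel {x \<in> ball 0 1. (\<Sum>j\<in>Basis. (c j * (x \<bullet> j))\<^sup>2) \<le> (norm x)\<^sup>2} * ennreal (\<Prod>j\<in>Basis. c j)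
    \<le> emeasure lborel (ball 0 1 :: 'a set)"
proof -
  \<comment> \<open>The summand 0 gives \<open>T\<close> the affine shape required by
    \<open>lborel_affine_euclidean\<close>.\<close>
  define T where "T x = 0 + (\<Sum>j\<in>Basis. (c j * (x \<bullet> j)) *\<^sub>R j)" for x :: 'a
  have [measurable]: "T \<in> borel_measurable borel"
    unfolding T_def by measurable
  have lb: "lborel = density (distr lborel borel T) (\<lambda>_. \<Prod>j\<in>Basis. \<bar>c j\<bar>)"
    unfolding T_def using c by (intro lborel_affine_euclidean) (metis less_irrefl)
  have abs: "(\<Prod>j\<in>Basis. \<bar>c j\<bar>) = (\<Prod>j\<in>Basis. c j)"
    using c by (intro prod.cong refl abs_of_pos)
  have normT: "(norm (T x))\<^sup>2 = (\<Sum>j\<in>Basis. (c j * (x \<bullet> j))\<^sup>2)" for x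
  proof -
    have "T x \<bullet> j = c j * (x \<bullet> j)" if "j \<in> Basis" for j
      using that by (simp add: T_def)
    then show ?thesis
      unfolding power2_norm_eq_inner by (subst euclidean_inner) (simp add: power2_eq_square)
  qed
  have "{x \<in> ball 0 1. (\<Sum>j\<in>Basis. (c j * (x \<bullet> j))\<^sup>2) \<le> (norm x)\<^sup>2} \<subseteq> T -` ball 0 1"
  proof
    fix x :: 'a
    assume "x \<in> {x \<in> ball 0 1. (\<Sum>j\<in>Basis. (c j * (x \<bullet> j))\<^sup>2) \<le> (norm x)\<^sup>2}"
    then have "(norm (T x))\<^sup>2 \<le> (norm x)\<^sup>2" "norm x < 1"
      unfolding normT by simp_all
    then have "norm (T x) < 1"
      using power2_le_imp_le[of "norm (T x)" "norm x"] by simp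
    then show "x \<in> T -` ball 0 1"
      by simp
  qed
  then have "emeasure lborel {x \<in> ball 0 1. (\<Sum>j\<in>Basis. (c j * (x \<bullet> j))\<^sup>2) \<le> (norm x)\<^sup>2}
      \<le> emeasure lborel (T -` ball 0 1)"
    using measurable_sets[of T borel borel "ball 0 1"] by (intro emeasure_mono) simp_all
  moreover have "emeasure lborel (ball 0 1 :: 'a set) = ennreal (\<Prod>j\<in>Basis. c j) * emeasure lborel (T -` ball 0 1)"
    by (subst lb) (simp add: emeasure_density_const emeasure_distr abs)
  ultimately show ?thesis
    by (simp add: mult.commute mult_left_mono)
qed

lemma borel_measurable_infdist [measurable]:
  "(\<lambda>x. infdist x S) \<in> borel_measurable borel"
  by (intro borel_measurable_continuous_onI continuous_intros)

lemma infdist_span_Basis_subset: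
  fixes B :: "'a::euclidean_space set"
  assumes "B \<subseteq> Basis"
  shows "(infdist x (span B))\<^sup>2 = (\<Sum>j\<in>Basis - B. (x \<bullet> j)\<^sup>2)"
proof -
  have finB: "finite B"
    using assms finite_Basis by (rule finite_subset)
  define y where "y = (\<Sum>j\<in>B. (x \<bullet> j) *\<^sub>R j)"
  have "x = (\<Sum>j\<in>Basis. (x \<bullet> j) *\<^sub>R j)"
    by (simp add: euclidean_representation)
  also have "\<dots> = (\<Sum>j\<in>Basis - B. (x \<bullet> j) *\<^sub>R j) + y"
    unfolding y_def using assms by (intro sum.subset_diff) auto
  finally have xy: "x - y = (\<Sum>j\<in>Basis - B. (x \<bullet> j) *\<^sub>R j)"
    by (simp add: algebra_simps)
  have inner: "(x - y) \<bullet> i = (if i \<in> B then 0 else x \<bullet> i)" if "i \<in> Basis" for i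
  proof -
    have "(x - y) \<bullet> i = (\<Sum>j\<in>Basis - B. if j = i then x \<bullet> i else 0)"
      unfolding xy inner_sum_left using that by (intro sum.cong) (auto simp: inner_Basis)
    then show ?thesis
      using that by (auto simp: sum.delta)
  qed
  have "infdist x (span B) = norm (x - y)"
  proof (rule infdist_subspace_eq_norm)
    show "y \<in> span B"
      unfolding y_def by (intro span_sum span_scale span_base)
    show "(x - y) \<bullet> w = 0" if "w \<in> span B" for w
    proof -
      have "orthogonal (x - y) w"
        using that by (rule orthogonal_to_span) (use inner assms in \<open>auto simp: orthogonal_def\<close>)
      then show ?thesis
        by (simp add: orthogonal_def)
    qed
  qed (rule subspace_span)
  then have "(infdist x (span B))\<^sup>2 = (\<Sum>i\<in>Basis. ((x - y) \<bullet> i) * ((x - y) \<bullet> i))"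
    by (simp only: power2_norm_eq_inner euclidean_inner[of "x - y" "x - y"])
  also have "\<dots> = (\<Sum>i\<in>Basis. if i \<in> Basis - B then (x \<bullet> i)\<^sup>2 else 0)"
    by (rule sum.cong) (auto simp: inner power2_eq_square)
  also have "\<dots> = (\<Sum>i\<in>Basis - B. (x \<bullet> i)\<^sup>2)"
    by (intro sum.mono_neutral_cong_right) auto
  finally show ?thesis .
qed

text \<open>The linear map that scales \<open>S\<close> by \<open>sqrt a\<close> and its orthogonal complement by \<open>sqrt b\<close>
  sends the set on the left into the unit ball; its determinant is the factor.\<close>

lemma emeasure_lborel_quadratic_cone:
  fixes S :: "'a::euclidean_space set"
  assumes S: "subspace S" and a: "a > 0" and b: "b > 0"
  shows "emeasure lborel {x \<in> ball 0 1. a * ((norm x)\<^sup>2 - (infdist x S)\<^sup>2) + b * (infdist x S)\<^sup>2 \<le> (norm x)\<^sup>2}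
      * ennreal (sqrt (a ^ dim S * b ^ (DIM('a) - dim S))) \<le> emeasure lborel (ball 0 1 :: 'a set)"
proof -
  let ?E = "\<lambda>S. {x \<in> ball 0 1. a * ((norm x)\<^sup>2 - (infdist x S)\<^sup>2) + b * (infdist x S)\<^sup>2 \<le> (norm x)\<^sup>2}"
  have [measurable]: "?E U \<in> sets borel" for U :: "'a set"
    by measurable
  \<comment> \<open>A rotation takes \<open>S\<close> to a coordinate subspace of the same
    dimension, where the scaling becomes diagonal.\<close>
  obtain B :: "'a set" where B: "B \<subseteq> Basis" "card B = dim S"
    using obtain_subset_with_card_n[OF dim_subset_UNIV[of S]] by metis
  have finB: "finite B"
    using B(1) finite_Basis by (rule finite_subset)
  have "dim (span B) = dim S"
    using B independent_mono[OF independent_Basis B(1)] by (simp add: dim_eq_card_independent)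
  then obtain Q where Q: "orthogonal_transformation Q" "Q ` S = span B"
    using orthogonal_transformation_between_subspaces[OF S subspace_span] by metis
  have QE: "Q -` ?E (span B) = ?E S"
  proof -
    have "norm (Q x) = norm x" for x
      using Q(1) by (rule orthogonal_transformation_norm)
    moreover have "infdist (Q x) (span B) = infdist x S" for x
      using orthogonal_transformation_infdist[OF Q(1), of x S] Q(2) by simp
    ultimately show ?thesis
      by auto
  qed
  have "emeasure lborel (?E (span B)) = emeasure (distr lborel borel Q) (?E (span B))"
    by (simp only: distr_lborel_orthogonal_transformation[OF Q(1)])
  also have "\<dots> = emeasure lborel (?E S)"
    using orthogonal_transformation_measurable[OF Q(1)] QE by (simp add: emeasure_distr)
  finally have eq: "emeasure lborel (?E S) = emeasure lborel (?E (span B))" ..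
  define c where "c j = (if j \<in> B then sqrt a else sqrt b)" for j :: 'a
  have quad: "a * ((norm x)\<^sup>2 - (infdist x (span B))\<^sup>2) + b * (infdist x (span B))\<^sup>2
      = (\<Sum>j\<in>Basis. (c j * (x \<bullet> j))\<^sup>2)" for x
  proof -
    have split: "(\<Sum>j\<in>Basis. g j) = (\<Sum>j\<in>Basis - B. g j) + (\<Sum>j\<in>B. g j)" for g :: "'a \<Rightarrow> real"
      using B(1) by (intro sum.subset_diff) auto
    have "(norm x)\<^sup>2 = (\<Sum>j\<in>Basis. (x \<bullet> j)\<^sup>2)"
      unfolding power2_norm_eq_inner by (subst euclidean_inner) (simp add: power2_eq_square)
    then have "(norm x)\<^sup>2 - (infdist x (span B))\<^sup>2 = (\<Sum>j\<in>B. (x \<bullet> j)\<^sup>2)"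
      by (simp add: infdist_span_Basis_subset[OF B(1)] split)
    moreover have "(\<Sum>j\<in>Basis - B. (c j * (x \<bullet> j))\<^sup>2) = (\<Sum>j\<in>Basis - B. b * (x \<bullet> j)\<^sup>2)"
      using b by (intro sum.cong) (auto simp: c_def power_mult_distrib)
    moreover have "(\<Sum>j\<in>B. (c j * (x \<bullet> j))\<^sup>2) = (\<Sum>j\<in>B. a * (x \<bullet> j)\<^sup>2)"
      using a by (intro sum.cong) (auto simp: c_def power_mult_distrib)
    ultimately show ?thesis
      by (simp add: split[of "\<lambda>j. (c j * (x \<bullet> j))\<^sup>2"] infdist_span_Basis_subset[OF B(1)] sum_distrib_left)
  qed
  have "(\<Prod>j\<in>Basis. c j) = (\<Prod>j\<in>Basis - B. c j) * (\<Prod>j\<in>B. c j)"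
    using B(1) by (intro prod.subset_diff) auto
  also have "(\<Prod>j\<in>Basis - B. c j) = sqrt b ^ (DIM('a) - dim S)"
    using B finB by (simp add: c_def card_Diff_subset)
  also have "(\<Prod>j\<in>B. c j) = sqrt a ^ dim S"
    using B by (simp add: c_def)
  finally have prod: "(\<Prod>j\<in>Basis. c j) = sqrt (a ^ dim S * b ^ (DIM('a) - dim S))"
    by (simp add: real_sqrt_mult real_sqrt_power)
  show ?thesis
    unfolding eq quad prod[symmetric]
    by (rule emeasure_lborel_diagonal_contraction) (simp add: c_def a b)
qed

text \<open>The choice of \<open>a\<close> and \<open>b\<close> makes both sides of the cone inequality agree on
  \<open>infdist x S ^ 2 = (1 - \<tau> m / d) * norm x ^ 2\<close>; the factor \<open>\<tau> - 1\<close> covers both tails at once.\<close>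

lemma emeasure_lborel_distance_cone_tail:
  fixes S :: "'a::euclidean_space set"
  assumes S: "subspace S" and m: "dim S = m" "m < DIM('a)"
    and \<tau>: "\<tau> > 0" "\<tau> * real m < real DIM('a)"
  shows "emeasure lborel {x \<in> ball 0 1. (\<tau> - 1) * ((infdist x S)\<^sup>2 - (1 - \<tau> * real m / real DIM('a)) * (norm x)\<^sup>2) \<le> 0}
    \<le> ennreal (exp (- (real m / 2 * (\<tau> - 1 - ln \<tau>)))) * emeasure lborel (ball 0 1 :: 'a set)"
proof -
  let ?d = "real DIM('a)"
  let ?E = "{x \<in> ball 0 1. (\<tau> - 1) * ((infdist x S)\<^sup>2 - (1 - \<tau> * real m / ?d) * (norm x)\<^sup>2) \<le> 0}"
  let ?V = "emeasure lborel (ball 0 1 :: 'a set)"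
  \<comment> \<open>With \<open>t = \<tau> * m / d\<close>, these values maximise
    \<open>a ^ m * b ^ (d - m)\<close> subject to \<open>a * t + b * (1 - t) = 1\<close>, by
    Lagrange multipliers.\<close>
  define a b where "a = 1 / \<tau>" and "b = (?d - real m) / (?d - \<tau> * real m)"
  have d: "?d > 0" by simp
  have a: "a > 0" and b: "b > 0"
    using \<tau> m(2) by (simp_all add: a_def b_def)
  \<comment> \<open>The factor after \<open>\<tau> - 1\<close> is positive, so the quadratic
    condition and the cone condition agree in sign for both tails.\<close>
  have ba: "b - a = (\<tau> - 1) * (?d / (\<tau> * (?d - \<tau> * real m)))"
    using \<tau> by (simp add: a_def b_def field_simps)
  have E: "?E = {x \<in> ball 0 1. a * ((norm x)\<^sup>2 - (infdist x S)\<^sup>2) + b * (infdist x S)\<^sup>2 \<le> (norm x)\<^sup>2}"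
  proof -
    have "a * (N - D) + b * D \<le> N \<longleftrightarrow> (\<tau> - 1) * (D - (1 - \<tau> * real m / ?d) * N) \<le> 0" for N D
    proof -
      have "(\<tau> - 1) * (?d / (\<tau> * (?d - \<tau> * real m))) * (1 - \<tau> * real m / ?d) = 1 - a"
        using \<tau> d by (simp add: a_def divide_simps)
      then have "(b - a) * (1 - \<tau> * real m / ?d) = 1 - a"
        by (simp only: ba)
      then have "a * (N - D) + b * D - N = (b - a) * (D - (1 - \<tau> * real m / ?d) * N)"
        by algebra
      also have "\<dots> = (\<tau> - 1) * (D - (1 - \<tau> * real m / ?d) * N) * (?d / (\<tau> * (?d - \<tau> * real m)))"
        by (simp only: ba mult_ac)
      finally have "a * (N - D) + b * D - N = (\<tau> - 1) * (D - (1 - \<tau> * real m / ?d) * N) * (?d / (\<tau> * (?d - \<tau> * real m)))" .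
      moreover have "?d / (\<tau> * (?d - \<tau> * real m)) > 0"
        using \<tau> d by simp
      ultimately show ?thesis
        by (metis diff_le_0_iff_le mult_le_0_iff not_less order_less_imp_le)
    qed
    then show ?thesis
      by simp
  qed
  define z where "z = real m / 2 * (\<tau> - 1 - ln \<tau>)"
  have "exp z \<le> sqrt (a ^ dim S * b ^ (DIM('a) - dim S))"
  proof (rule real_le_rsqrt)
    \<comment> \<open>Applying \<open>1 + x \<le> exp x\<close> to \<open>1 / b\<close> bounds
      \<open>b ^ (d - m)\<close> below by \<open>exp ((\<tau> - 1) * m)\<close>, which no longer
      depends on \<open>d\<close>.\<close>
    have "1 / b = 1 + - ((\<tau> - 1) * real m / (?d - real m))"
      using \<tau> m(2) by (simp add: b_def field_simps)
    also have "\<dots> \<le> exp (- ((\<tau> - 1) * real m / (?d - real m)))"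
      by (rule exp_ge_add_one_self)
    finally have "exp ((\<tau> - 1) * real m / (?d - real m)) \<le> b"
      using b by (simp add: exp_minus field_simps)
    then have "exp ((\<tau> - 1) * real m / (?d - real m)) ^ (DIM('a) - m) \<le> b ^ (DIM('a) - m)"
      by (intro power_mono) auto
    moreover have "exp ((\<tau> - 1) * real m / (?d - real m)) ^ (DIM('a) - m) = exp ((\<tau> - 1) * real m)"
      using m(2) by (simp add: exp_of_nat_mult[symmetric] of_nat_diff)
    moreover have "a ^ m = exp (- (real m * ln \<tau>))"
      using \<tau> by (simp add: a_def exp_minus exp_of_nat_mult inverse_eq_divide power_divide)
    ultimately have "exp (- (real m * ln \<tau>)) * exp ((\<tau> - 1) * real m) \<le> a ^ m * b ^ (DIM('a) - m)"
      by simp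
    moreover have "(exp z)\<^sup>2 = exp (- (real m * ln \<tau>)) * exp ((\<tau> - 1) * real m)"
      by (simp add: z_def exp_add[symmetric] power2_eq_square field_simps)
    ultimately show "(exp z)\<^sup>2 \<le> a ^ dim S * b ^ (DIM('a) - dim S)"
      by (simp add: m)
  qed
  then have "emeasure lborel ?E * ennreal (exp z) \<le> emeasure lborel ?E * ennreal (sqrt (a ^ dim S * b ^ (DIM('a) - dim S)))"
    by (intro mult_left_mono ennreal_leI) auto
  also have "\<dots> \<le> ?V"
    unfolding E by (rule emeasure_lborel_quadratic_cone[OF S a b])
  finally have *: "emeasure lborel ?E * ennreal (exp z) \<le> ?V" .
  have "emeasure lborel ?E = emeasure lborel ?E * ennreal (exp z) * ennreal (exp (- z))"
    by (simp add: mult.assoc ennreal_mult[symmetric] exp_add[symmetric])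
  also have "\<dots> \<le> ?V * ennreal (exp (- z))"
    using * by (rule mult_right_mono) simp
  finally show ?thesis
    by (simp add: z_def mult.commute)
qed

section \<open>The span of random vectors\<close>

lemma prob_space_unif_sphere: "prob_space (unif_sphere :: 'a::euclidean_space measure)"
  unfolding unif_sphere_def
  using emeasure_lborel_unit_ball[where 'a='a]
  by (intro prob_space.prob_space_distr prob_space_uniform_measure) auto

lemma sets_unif_sphere [simp, measurable_cong]: "sets unif_sphere = sets borel"
  by (simp add: unif_sphere_def)

lemma space_unif_sphere [simp]: "space unif_sphere = UNIV"
  by (simp add: unif_sphere_def)

text \<open>Normalisation commutes with \<open>Q\<close>, so the invariance is inherited from the
  uniform measure on the ball.\<close>

lemma distr_unif_sphere_orthogonal_transformation:
  fixes Q :: "'a::euclidean_space \<Rightarrow> 'a"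
  assumes Q: "orthogonal_transformation Q"
  shows "distr unif_sphere unif_sphere Q = unif_sphere"
proof -
  note [measurable] = orthogonal_transformation_measurable[OF Q]
  let ?U = "uniform_measure lborel (ball 0 1 :: 'a set)"
  let ?n = "\<lambda>x::'a. x /\<^sub>R norm x"
  have normQ: "norm (Q x) = norm x" for x
    using Q by (rule orthogonal_transformation_norm)
  have U: "distr ?U borel Q = ?U"
  proof (rule measure_eqI)
    fix A assume "A \<in> sets (distr ?U borel Q)"
    then have [measurable]: "A \<in> sets borel" by simp
    have "emeasure (distr ?U borel Q) A = emeasure lborel (ball 0 1 \<inter> Q -` A) / emeasure lborel (ball 0 1 :: 'a set)"
      using measurable_sets[of Q borel borel A] by (simp add: emeasure_distr)
    also have "ball 0 1 \<inter> Q -` A = Q -` (ball 0 1 \<inter> A)"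
      using orthogonal_transformation_vimage_ball[OF Q] by auto
    also have "emeasure lborel (Q -` (ball 0 1 \<inter> A)) = emeasure (distr lborel borel Q) (ball 0 1 \<inter> A)"
      by (subst emeasure_distr) auto
    also have "\<dots> = emeasure lborel (ball 0 1 \<inter> A)"
      by (simp only: distr_lborel_orthogonal_transformation[OF Q])
    finally show "emeasure (distr ?U borel Q) A = emeasure ?U A"
      by simp
  qed simp
  have "distr unif_sphere unif_sphere Q = distr (distr ?U borel ?n) borel Q"
    by (intro distr_cong) (simp_all add: unif_sphere_def)
  also have "\<dots> = distr ?U borel (Q \<circ> ?n)"
    by (simp add: distr_distr)
  also have "Q \<circ> ?n = ?n \<circ> Q"
    using Q by (auto simp: normQ orthogonal_transformation_linear linear_scale)
  also have "distr ?U borel (?n \<circ> Q) = distr (distr ?U borel Q) borel ?n"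
    by (simp add: distr_distr)
  finally show ?thesis
    by (simp add: U unif_sphere_def)
qed

text \<open>A subspace is a cone, so the points of the ball that normalise into \<open>S\<close>
  already lie in \<open>S\<close>, a Lebesgue null set.\<close>

lemma emeasure_unif_sphere_proper_subspace:
  fixes S :: "'a::euclidean_space set"
  assumes S: "subspace S" and dim: "dim S < DIM('a)"
  shows "emeasure unif_sphere S = 0"
proof -
  have [measurable]: "S \<in> sets borel"
    using closed_subspace[OF S] by simp
  let ?n = "\<lambda>x::'a. x /\<^sub>R norm x"
  have "S \<in> null_sets (completion lborel)"
    using negligible_lowdim[OF dim] by (simp add: negligible_iff_null_sets)
  then have S0: "emeasure lborel S = 0"
    by (simp add: null_sets_completion_iff null_setsD1)
  have "ball 0 1 \<inter> ?n -` S \<subseteq> S"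
  proof
    fix x assume "x \<in> ball 0 1 \<inter> ?n -` S"
    then have "?n x \<in> S"
      by blast
    then have "norm x *\<^sub>R ?n x \<in> S"
      by (rule subspace_scale[OF S])
    \<comment> \<open>At \<open>x = 0\<close> the normalisation returns 0, which belongs to
      \<open>S\<close> as well.\<close>
    then show "x \<in> S"
      by (cases "x = 0") auto
  qed
  then have "emeasure lborel (ball 0 1 \<inter> ?n -` S) \<le> emeasure lborel S"
    by (rule emeasure_mono) simp
  then have "emeasure lborel (ball 0 1 \<inter> ?n -` S) = 0"
    using S0 by simp
  moreover have "?n -` S \<in> sets borel"
    using measurable_sets[of ?n borel borel S] by simp
  ultimately show ?thesis
    by (simp add: unif_sphere_def emeasure_distr)
qed

lemma sets_rand_vectors [measurable_cong]: "sets (rand_vectors m) = sets (PiM {..<m} (\<lambda>_. borel))"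
  unfolding rand_vectors_def by (intro sets_PiM_cong) auto

lemma borel_measurable_rand_vectors_component [measurable (raw)]:
  "j < m \<Longrightarrow> (\<lambda>v. v j) \<in> borel_measurable (rand_vectors m)"
  by (simp add: measurable_component_singleton cong: measurable_cong_sets[OF sets_rand_vectors refl])

lemma prob_space_rand_vectors: "prob_space (rand_vectors m :: (nat \<Rightarrow> 'a::euclidean_space) measure)"
  unfolding rand_vectors_def by (intro prob_space_PiM prob_space_unif_sphere)

lemma distr_rand_vectors_orthogonal_transformation:
  fixes Q :: "'a::euclidean_space \<Rightarrow> 'a"
  assumes Q: "orthogonal_transformation Q"
  shows "distr (rand_vectors m) (rand_vectors m) (compose {..<m} Q) = rand_vectors m"
  unfolding rand_vectors_def
  using distr_PiM_finite_prob_space'[of "{..<m}" "\<lambda>_. unif_sphere" "\<lambda>_. unif_sphere" Q]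
    orthogonal_transformation_measurable[OF Q]
  by (simp add: prob_space_unif_sphere distr_unif_sphere_orthogonal_transformation[OF Q])

section \<open>Measurability of the distance to a random span, and its dimension\<close>

lemma span_image_eq_range_sum:
  fixes v :: "'i \<Rightarrow> 'a::real_vector"
  assumes "finite I"
  shows "span (v ` I) = range (\<lambda>u. \<Sum>i\<in>I. u i *\<^sub>R v i)"
proof
  have "subspace (range (\<lambda>u. \<Sum>i\<in>I. u i *\<^sub>R v i))"
  proof (rule subspaceI)
    show "0 \<in> range (\<lambda>u. \<Sum>i\<in>I. u i *\<^sub>R v i)"
      by (rule range_eqI[of _ _ "\<lambda>_. 0"]) simp
  next
    fix x y assume "x \<in> range (\<lambda>u. \<Sum>i\<in>I. u i *\<^sub>R v i)" "y \<in> range (\<lambda>u. \<Sum>i\<in>I. u i *\<^sub>R v i)"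
    then obtain u w where "x = (\<Sum>i\<in>I. u i *\<^sub>R v i)" "y = (\<Sum>i\<in>I. w i *\<^sub>R v i)"
      by auto
    then show "x + y \<in> range (\<lambda>u. \<Sum>i\<in>I. u i *\<^sub>R v i)"
      by (intro range_eqI[of _ _ "\<lambda>i. u i + w i"]) (simp add: scaleR_add_left sum.distrib)
  next
    fix c x assume "x \<in> range (\<lambda>u. \<Sum>i\<in>I. u i *\<^sub>R v i)"
    then obtain u where "x = (\<Sum>i\<in>I. u i *\<^sub>R v i)"
      by auto
    then show "c *\<^sub>R x \<in> range (\<lambda>u. \<Sum>i\<in>I. u i *\<^sub>R v i)"
      by (intro range_eqI[of _ _ "\<lambda>i. c * u i"]) (simp add: scaleR_sum_right)
  qed
  moreover have "v j \<in> range (\<lambda>u. \<Sum>i\<in>I. u i *\<^sub>R v i)" if "j \<in> I" for j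
  proof (rule range_eqI)
    have "(\<Sum>i\<in>I. (if i = j then 1 else 0) *\<^sub>R v i) = (\<Sum>i\<in>I. if i = j then v i else 0)"
      by (rule sum.cong) auto
    then show "v j = (\<Sum>i\<in>I. (if i = j then 1 else 0) *\<^sub>R v i)"
      using assms that by simp
  qed
  ultimately show "span (v ` I) \<subseteq> range (\<lambda>u. \<Sum>i\<in>I. u i *\<^sub>R v i)"
    by (intro span_minimal) auto
  show "range (\<lambda>u. \<Sum>i\<in>I. u i *\<^sub>R v i) \<subseteq> span (v ` I)"
    by (rule image_subsetI) (intro span_sum span_scale span_base imageI)
qed

text \<open>Rational coefficients are dense, so a countable infimum suffices; this is what makes the
  distance to a random span measurable. Extensional coefficient functions keep the index set
  countable.\<close>

lemma infdist_span_image_eq_INF_Rats: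
  fixes v :: "'i \<Rightarrow> 'a::euclidean_space"
  assumes "finite I"
  shows "infdist x (span (v ` I)) = (INF c\<in>Pi\<^sub>E I (\<lambda>_. \<rat>). dist x (\<Sum>i\<in>I. c i *\<^sub>R v i))"
proof (rule antisym)
  let ?C = "Pi\<^sub>E I (\<lambda>_. \<rat> :: real set)"
  let ?s = "\<lambda>c. \<Sum>i\<in>I. c i *\<^sub>R v i"
  have ne: "?C \<noteq> {}"
    by (auto simp: PiE_eq_empty_iff)
  have bdd: "bdd_below ((\<lambda>c. dist x (?s c)) ` ?C)"
    by (rule bdd_belowI[of _ 0]) auto
  show "infdist x (span (v ` I)) \<le> (INF c\<in>?C. dist x (?s c))"
    using ne by (intro cINF_greatest infdist_le) (auto simp: span_image_eq_range_sum[OF assms])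
  have "(INF c\<in>?C. dist x (?s c)) \<le> dist x w" if w_span: "w \<in> span (v ` I)" for w
  proof -
    obtain u where w: "w = ?s u"
      using w_span unfolding span_image_eq_range_sum[OF assms] by blast
    have "\<exists>f. (\<forall>n. f n \<in> \<rat>) \<and> f \<longlonglongrightarrow> u i" for i
      using Rats_closure_real closure_sequential[of "u i" \<rat>] by blast
    then obtain f where f: "\<And>i n. f i n \<in> \<rat>" "\<And>i. f i \<longlonglongrightarrow> u i"
      by metis
    have "(\<lambda>n. dist x (\<Sum>i\<in>I. f i n *\<^sub>R v i)) \<longlonglongrightarrow> dist x (?s u)"
      by (intro tendsto_intros f)
    moreover have "(INF c\<in>?C. dist x (?s c)) \<le> dist x (\<Sum>i\<in>I. f i n *\<^sub>R v i)" for n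
    proof -
      have "(\<lambda>i\<in>I. f i n) \<in> ?C"
        using f by auto
      then have "(INF c\<in>?C. dist x (?s c)) \<le> dist x (?s (\<lambda>i\<in>I. f i n))"
        by (rule cINF_lower[OF bdd])
      then show ?thesis
        by simp
    qed
    ultimately show ?thesis
      unfolding w by (intro tendsto_lowerbound[of _ _ sequentially]) auto
  qed
  then show "(INF c\<in>?C. dist x (?s c)) \<le> infdist x (span (v ` I))"
    using span_zero[of "v ` I"] by (subst infdist_notempty) (auto intro!: cINF_greatest)
qed

lemma borel_measurable_infdist_span [measurable (raw)]:
  fixes g :: "'b \<Rightarrow> 'a::euclidean_space" and v :: "'b \<Rightarrow> nat \<Rightarrow> 'a"
  assumes [measurable]: "g \<in> borel_measurable N" "\<And>i. i < n \<Longrightarrow> (\<lambda>\<omega>. v \<omega> i) \<in> borel_measurable N"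
  shows "(\<lambda>\<omega>. infdist (g \<omega>) (span (v \<omega> ` {..<n}))) \<in> borel_measurable N"
  unfolding infdist_span_image_eq_INF_Rats[OF finite_lessThan]
  by (intro borel_measurable_cINF_real countable_PiE countable_rat) auto

text \<open>Fubini with the \<open>i\<close>-th vector integrated first: for fixed other vectors,
  the bad values lie in the span of the first \<open>i\<close> ones, a null set because its
  dimension is at most \<open>i\<close>, hence below that of the space.\<close>

lemma AE_rand_vectors_infdist_pos:
  assumes i: "i < m" and m: "m \<le> DIM('a::euclidean_space)"
  shows "AE v in rand_vectors m. infdist (v i :: 'a) (span (v ` {..<i})) \<noteq> 0"
proof -
  interpret product_prob_space "\<lambda>_::nat. unif_sphere :: 'a measure"
    by (rule product_prob_spaceI) (rule prob_space_unif_sphere)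
  let ?R = "rand_vectors m :: (nat \<Rightarrow> 'a) measure"
  let ?J = "{..<m} - {i}"
  have ins: "insert i ?J = {..<m}"
    using i by auto
  define N where "N = {v \<in> space ?R. infdist (v i) (span (v ` {..<i})) \<le> 0}"
  have [measurable]: "(\<lambda>v. infdist (v i) (span (v ` {..<i}))) \<in> borel_measurable ?R"
    using i by (intro borel_measurable_infdist_span borel_measurable_rand_vectors_component) auto
  have [measurable]: "N \<in> sets ?R"
    unfolding N_def using i by measurable
  have "emeasure ?R N = (\<integral>\<^sup>+v. indicator N v \<partial>Pi\<^sub>M (insert i ?J) (\<lambda>_. unif_sphere))"
    unfolding ins rand_vectors_def[symmetric] by simp
  also have "\<dots> = (\<integral>\<^sup>+v. \<integral>\<^sup>+y. indicator N (v(i := y)) \<partial>unif_sphere \<partial>Pi\<^sub>M ?J (\<lambda>_. unif_sphere))"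
    by (rule product_nn_integral_insert) (unfold ins rand_vectors_def[symmetric], auto)
  also have "\<dots> = (\<integral>\<^sup>+v. 0 \<partial>Pi\<^sub>M ?J (\<lambda>_. unif_sphere :: 'a measure))"
  proof (rule nn_integral_cong)
    fix v :: "nat \<Rightarrow> 'a"
    let ?S = "span (v ` {..<i})"
    have [measurable]: "?S \<in> sets borel"
      using closed_subspace[OF subspace_span] by simp
    have "dim ?S \<le> card (v ` {..<i})"
      by (simp add: dim_le_card')
    also have "\<dots> \<le> i"
      using card_image_le[of "{..<i}" v] by simp
    finally have "emeasure unif_sphere ?S = 0"
      using i m by (intro emeasure_unif_sphere_proper_subspace) auto
    moreover have "(\<integral>\<^sup>+y. indicator N (v(i := y)) \<partial>unif_sphere) \<le> (\<integral>\<^sup>+y. indicator ?S y \<partial>unif_sphere)"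
    proof (intro nn_integral_mono)
      fix y
      have "y \<in> ?S" if "v(i := y) \<in> N"
      proof -
        have "(v(i := y)) ` {..<i} = v ` {..<i}"
          by auto
        then have "infdist y ?S = 0"
          using that infdist_nonneg[of y ?S] by (simp add: N_def)
        then show ?thesis
          using in_closed_iff_infdist_zero[OF closed_subspace[OF subspace_span], of "v ` {..<i}" y] span_zero by blast
      qed
      then show "indicator N (v(i := y)) \<le> (indicator ?S y :: ennreal)"
        by (auto simp: indicator_def)
    qed
    ultimately show "(\<integral>\<^sup>+y. indicator N (v(i := y)) \<partial>unif_sphere) = 0"
      by simp
  qed
  finally have "N \<in> null_sets ?R"
    by (simp add: null_sets_def)
  then show ?thesis
    by (rule AE_I') (auto simp: N_def)
qed

lemma AE_rand_vectors_dim_span: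
  assumes "m \<le> DIM('a::euclidean_space)"
  shows "AE v in rand_vectors m. dim (span (v ` {..<m} :: 'a set)) = m"
proof -
  have "AE v in rand_vectors m. \<forall>i\<in>{..<m}. infdist (v i :: 'a) (span (v ` {..<i})) \<noteq> 0"
    by (rule AE_finite_allI) (use AE_rand_vectors_infdist_pos assms in auto)
  then show ?thesis
  proof (eventually_elim)
    case (elim v)
    have "dim (v ` {..<n}) = n" if "n \<le> m" for n
      using that
    proof (induction n)
      case (Suc n)
      then have "v n \<notin> span (v ` {..<n})"
        using elim by (metis Suc_le_eq infdist_zero lessThan_iff)
      then show ?case
        using Suc by (simp add: lessThan_Suc dim_insert)
    qed simp
    then show ?case
      by simp
  qed
qed

lemma infdist_scaleR_subspace:
  fixes S :: "'a::euclidean_space set"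
  assumes "subspace S"
  shows "infdist (c *\<^sub>R x) S = \<bar>c\<bar> * infdist x S"
proof -
  obtain P where P: "linear P" "\<And>x. P x \<in> S" "\<And>x y. y \<in> S \<Longrightarrow> (x - P x) \<bullet> y = 0"
    using subspace_orthogonal_projection[OF assms] by metis
  have inf: "infdist x S = norm (x - P x)" for x
    using P assms by (intro infdist_subspace_eq_norm)
  have "c *\<^sub>R x - P (c *\<^sub>R x) = c *\<^sub>R (x - P x)"
    using P(1) by (simp add: linear_scale scaleR_diff_right)
  then show ?thesis
    by (simp add: inf)
qed

text \<open>The probability for a fixed \<open>n\<close> equals its average over all directions in
  the ball. After exchanging the integrals, the cone volume bound applies for almost every choice of
  the random vectors, namely whenever their span has dimension \<open>m\<close>.\<close>

lemma rand_vectors_distance_tail: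
  fixes n :: "'a::euclidean_space"
  assumes n: "norm n = 1" and m: "m < DIM('a)"
    and \<tau>: "\<tau> > 0" "\<tau> * real m < real DIM('a)"
  shows "measure (rand_vectors m) {v \<in> space (rand_vectors m).
      (\<tau> - 1) * ((infdist n (span (v ` {..<m})))\<^sup>2 - (1 - \<tau> * real m / real DIM('a))) \<le> 0}
    \<le> exp (- (real m / 2 * (\<tau> - 1 - ln \<tau>)))"
proof -
  let ?R = "rand_vectors m :: (nat \<Rightarrow> 'a) measure"
  let ?B = "ball 0 1 :: 'a set"
  \<comment> \<open>Multiplying by \<open>(norm x) ^ 2\<close> makes the condition homogeneous in
    \<open>x\<close>, so it depends only on the line through \<open>x\<close>.\<close>
  define H where "H v x \<longleftrightarrow> (\<tau> - 1) * ((infdist x (span (v ` {..<m})))\<^sup>2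
      - (1 - \<tau> * real m / real DIM('a)) * (norm x)\<^sup>2) \<le> 0" for v :: "nat \<Rightarrow> 'a" and x
  define p where "p = exp (- (real m / 2 * (\<tau> - 1 - ln \<tau>)))"
  interpret R: prob_space ?R
    by (rule prob_space_rand_vectors)
  interpret pair_sigma_finite ?R lborel
    by unfold_locales
  have H1: "{v \<in> space ?R. H v x} \<in> sets ?R" for x
    unfolding H_def by measurable
  have H2: "{x \<in> ?B. H v x} \<in> sets borel" for v
    unfolding H_def by measurable
  have comp2: "(\<lambda>z. fst z j) \<in> borel_measurable (?R \<Otimes>\<^sub>M lborel)" if "j < m" for j
    using measurable_compose[OF measurable_fst borel_measurable_rand_vectors_component[OF that]] .
  have [measurable]: "(\<lambda>z. infdist (snd z) (span (fst z ` {..<m}))) \<in> borel_measurable (?R \<Otimes>\<^sub>M lborel)"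
    using comp2 by (intro borel_measurable_infdist_span) auto
  have H3: "{z \<in> space (?R \<Otimes>\<^sub>M lborel). norm (snd z) < 1 \<and> H (fst z) (snd z)} \<in> sets (?R \<Otimes>\<^sub>M lborel)"
    unfolding H_def by measurable
  have rot: "emeasure ?R {v \<in> space ?R. H v x} = emeasure ?R {v \<in> space ?R. H v n}" if "x \<noteq> 0" for x
  proof -
    \<comment> \<open>Only lines are matched: \<open>Q\<close> takes \<open>n\<close> to a multiple
      of \<open>x\<close>, possibly of opposite sign and different length, and homogeneity removes
      the factor \<open>c\<close>.\<close>
    have "dim (span {n}) = dim (span {x})"
      using that n by (auto simp: dim_insert)
    then obtain Q where Q: "orthogonal_transformation Q" "Q ` span {n} = span {x}"
      using orthogonal_transformation_between_subspaces by blast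
    have linQ: "linear Q"
      using Q(1) by (rule orthogonal_transformation_linear)
    obtain c where c: "x = Q (c *\<^sub>R n)"
    proof -
      have "x \<in> Q ` span {n}"
        using Q(2) by (simp add: span_base)
      then show ?thesis
        using that by (auto simp: span_singleton)
    qed
    have normx: "norm x = \<bar>c\<bar>"
      using c n orthogonal_transformation_norm[OF Q(1), of "c *\<^sub>R n"] by simp
    then have c0: "c \<noteq> 0"
      using that by auto
    have meas: "compose {..<m} Q \<in> measurable ?R ?R"
      unfolding rand_vectors_def compose_def
      using orthogonal_transformation_measurable[OF Q(1)]
      by (intro measurable_restrict measurable_compose[OF measurable_component_singleton]) auto
    have "H (compose {..<m} Q v) x \<longleftrightarrow> H v n" for v
    proof -
      have "compose {..<m} Q v ` {..<m} = Q ` v ` {..<m}"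
        by (auto simp: compose_def)
      then have "span (compose {..<m} Q v ` {..<m}) = Q ` span (v ` {..<m})"
        using linear_span_image[OF linQ] by simp
      then have "infdist x (span (compose {..<m} Q v ` {..<m})) = \<bar>c\<bar> * infdist n (span (v ` {..<m}))"
        by (simp add: c orthogonal_transformation_infdist[OF Q(1)] infdist_scaleR_subspace subspace_span)
      then have "(\<tau> - 1) * ((infdist x (span (compose {..<m} Q v ` {..<m})))\<^sup>2
          - (1 - \<tau> * real m / real DIM('a)) * (norm x)\<^sup>2)
        = c\<^sup>2 * ((\<tau> - 1) * ((infdist n (span (v ` {..<m})))\<^sup>2 - (1 - \<tau> * real m / real DIM('a)) * (norm n)\<^sup>2))"
        by (simp add: normx n power_mult_distrib algebra_simps)
      then show ?thesis
        unfolding H_def using mult_le_cancel_left_pos[of "c\<^sup>2" _ 0] c0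
        by (simp only: mult_zero_right zero_less_power2 simp_thms)
    qed
    then have vim: "compose {..<m} Q -` {v \<in> space ?R. H v x} \<inter> space ?R = {v \<in> space ?R. H v n}"
      using measurable_space[OF meas] by auto
    have "emeasure ?R {v \<in> space ?R. H v x} = emeasure (distr ?R ?R (compose {..<m} Q)) {v \<in> space ?R. H v x}"
      by (simp only: distr_rand_vectors_orthogonal_transformation[OF Q(1)])
    also have "\<dots> = emeasure ?R {v \<in> space ?R. H v n}"
      by (simp only: emeasure_distr[OF meas H1] vim)
    finally show ?thesis .
  qed
  let ?K = "\<lambda>v x. indicator {z. norm (snd z) < 1 \<and> H (fst z) (snd z)} (v, x) :: ennreal"
  have K: "(\<lambda>(v, x). ?K v x) \<in> borel_measurable (?R \<Otimes>\<^sub>M lborel)"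
  proof -
    have "indicator {z \<in> space (?R \<Otimes>\<^sub>M lborel). norm (snd z) < 1 \<and> H (fst z) (snd z)} \<in> borel_measurable (?R \<Otimes>\<^sub>M lborel)"
      using H3 by (rule borel_measurable_indicator)
    then show ?thesis
      by (rule measurable_cong[THEN iffD1, rotated]) (auto simp: indicator_def)
  qed
  have "emeasure ?R {v \<in> space ?R. H v n} * emeasure lborel ?B
      = (\<integral>\<^sup>+x. emeasure ?R {v \<in> space ?R. H v n} * indicator ?B x \<partial>lborel)"
    by (subst nn_integral_cmult_indicator) simp_all
  \<comment> \<open>The origin has no direction and is discarded as a null set.\<close>
  also have "\<dots> = (\<integral>\<^sup>+x. \<integral>\<^sup>+v. ?K v x \<partial>?R \<partial>lborel)"
  proof (rule nn_integral_cong_AE, use AE_lborel_singleton[of 0] in eventually_elim)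
    case (elim x)
    have "(\<integral>\<^sup>+v. ?K v x \<partial>?R) = (\<integral>\<^sup>+v. indicator ?B x * indicator {v \<in> space ?R. H v x} v \<partial>?R)"
      by (rule nn_integral_cong) (auto simp: indicator_def)
    also have "\<dots> = indicator ?B x * emeasure ?R {v \<in> space ?R. H v x}"
      using H1[of x] by (simp add: nn_integral_cmult)
    finally show ?case
      using rot[OF elim] by (simp add: mult.commute)
  qed
  also have "\<dots> = (\<integral>\<^sup>+v. \<integral>\<^sup>+x. ?K v x \<partial>lborel \<partial>?R)"
    by (rule Fubini'[OF K])
  also have "\<dots> \<le> (\<integral>\<^sup>+v. ennreal p * emeasure lborel ?B \<partial>?R)"
  proof (rule nn_integral_mono_AE)
    have "AE v in ?R. dim (span (v ` {..<m})) = m"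
      using m by (intro AE_rand_vectors_dim_span) simp
    then show "AE v in ?R. (\<integral>\<^sup>+x. ?K v x \<partial>lborel) \<le> ennreal p * emeasure lborel ?B"
    proof eventually_elim
      case (elim v)
      have "(\<integral>\<^sup>+x. ?K v x \<partial>lborel) = (\<integral>\<^sup>+x. indicator {x \<in> ?B. H v x} x \<partial>lborel)"
        by (rule nn_integral_cong) (auto simp: indicator_def)
      also have "\<dots> = emeasure lborel {x \<in> ?B. H v x}"
        using H2[of v] by simp
      also have "\<dots> \<le> ennreal p * emeasure lborel ?B"
        unfolding H_def p_def by (rule emeasure_lborel_distance_cone_tail[OF subspace_span elim m \<tau>])
      finally show ?case .
    qed
  qed
  also have "\<dots> = ennreal p * emeasure lborel ?B"
    by (simp add: R.emeasure_space_1)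
  finally have "emeasure ?R {v \<in> space ?R. H v n} * emeasure lborel ?B \<le> ennreal p * emeasure lborel ?B" .
  then have "emeasure lborel ?B * emeasure ?R {v \<in> space ?R. H v n} \<le> emeasure lborel ?B * ennreal p"
    by (simp only: mult.commute)
  then have "emeasure ?R {v \<in> space ?R. H v n} \<le> ennreal p"
    using emeasure_lborel_unit_ball[where 'a='a]
    by (subst (asm) ennreal_mult_le_mult_iff) auto
  then have "measure ?R {v \<in> space ?R. H v n} \<le> p"
    by (simp add: R.emeasure_eq_measure p_def)
  then show ?thesis
    by (simp add: H_def p_def n)
qed

section \<open>Balls touching the decision boundary\<close>

text \<open>Disjointness keeps the centres at least the sum of the radii apart. As both spheres pass
  through \<open>p\<close>, the triangle inequality for \<open>a\<close> and \<open>- b\<close> is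
  an equality, which forces opposite directions.\<close>

lemma disjoint_balls_opposite_centres:
  fixes a b p :: "'a::real_inner"
  assumes disj: "ball (p + a) (norm a) \<inter> ball (p + b) (norm b) = {}" and a: "a \<noteq> 0" and b: "b \<noteq> 0"
  shows "norm a *\<^sub>R b = - (norm b *\<^sub>R a)"
proof -
  have pos: "norm a > 0" "norm b > 0"
    using a b by auto
  have "norm (a - b) \<ge> norm a + norm b"
  proof (rule ccontr)
    assume "\<not> norm (a - b) \<ge> norm a + norm b"
    then have lt: "norm (a - b) / (norm a + norm b) < 1"
      using add_pos_pos[OF pos] by (simp add: pos_divide_less_eq)
    \<comment> \<open>The point \<open>y\<close> divides the segment between the centres in the
      ratio of the radii; if the centres were too close, it would lie in both balls.\<close>
    define t where "t = norm a / (norm a + norm b)"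
    define y where "y = p + a + t *\<^sub>R (b - a)"
    have t: "0 \<le> t" "1 - t = norm b / (norm a + norm b)"
      using add_pos_pos[OF pos] by (simp_all add: t_def diff_divide_eq_iff)
    have "dist (p + a) y = t * norm (a - b)"
      using t by (simp add: y_def dist_norm norm_minus_commute)
    also have "\<dots> = norm a * (norm (a - b) / (norm a + norm b))"
      by (simp add: t_def)
    also have "\<dots> < norm a"
      using mult_strict_left_mono[OF lt pos(1)] by (simp only: mult_1_right)
    finally have ya: "y \<in> ball (p + a) (norm a)" by simp
    have "p + b - y = (1 - t) *\<^sub>R (b - a)"
      by (simp add: y_def algebra_simps)
    then have "dist (p + b) y = norm b / (norm a + norm b) * norm (a - b)"
      unfolding dist_norm using t(2) pos by (simp add: norm_minus_commute)
    also have "\<dots> = norm b * (norm (a - b) / (norm a + norm b))"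
      by simp
    also have "\<dots> < norm b"
      using mult_strict_left_mono[OF lt pos(2)] by (simp only: mult_1_right)
    finally show False
      using ya disj by auto
  qed
  then have "norm (a + - b) = norm a + norm (- b)"
    using norm_triangle_ineq[of a "- b"] by simp
  then have "norm a *\<^sub>R (- b) = norm (- b) *\<^sub>R a"
    by (simp only: norm_triangle_eq)
  then show ?thesis
    by simp (metis minus_minus)
qed

section \<open>Curvature and the radii of touching balls\<close>

lemma q_dir_nonneg: "0 \<le> q_dir f i j p"
  \<comment> \<open>The witness \<open>z = p\<close> gives the empty ball of radius 0.\<close>
  unfolding q_dir_def by (rule Sup_upper2[of "ereal (norm (p - p))"]) (auto intro!: exI[of _ p])

lemma q_bd_nonneg: "0 \<le> q_bd f i j"
  unfolding q_bd_def q_pt_def by (intro INF_greatest) (simp add: q_dir_nonneg)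

lemma inverse_less_if_inverse_ereal_less:
  fixes q :: ereal
  assumes "0 \<le> q" "inverse q = ereal c" "c < c'"
  shows "ereal (1 / c') < q"
proof (cases q)
  case (real x)
  then have x: "x > 0"
    using assms by (cases "x = 0") auto
  then have c: "c = 1 / x"
    using assms real by (simp add: inverse_eq_divide)
  then have "0 < c"
    using x by simp
  then have "0 < c'"
    using assms(3) by simp
  moreover have "1 < c' * x"
    using assms(3) c x by (simp add: field_simps)
  ultimately show ?thesis
    using real by (simp add: field_simps)
qed (use assms in auto)

text \<open>The suprema in \<open>q_dir\<close> need not be attained, so balls of radius
  \<open>1 / c\<close> may be missing; any \<open>c' > c\<close> leaves room for actual balls. This
  also covers \<open>c = 0\<close>, where the radii are unbounded.\<close>

lemma ball_in_region_at_boundary: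
  assumes p: "p \<in> dboundary f i j" and c: "curv f i j = ereal c" "c < c'"
  obtains a b where "norm a > 1 / c'" "ball (p + a) (norm a) \<subseteq> region f i j"
    "norm b > 1 / c'" "ball (p + b) (norm b) \<subseteq> region f j i"
proof -
  have "ereal (1 / c') < q_bd f i j"
    using c q_bd_nonneg by (intro inverse_less_if_inverse_ereal_less) (auto simp: curv_def)
  also have "\<dots> \<le> q_pt f i j p"
    unfolding q_bd_def using p by (rule INF_lower)
  finally have "ereal (1 / c') < q_dir f i j p" "ereal (1 / c') < q_dir f j i p"
    by (simp_all add: q_pt_def)
  then obtain z w where "1 / c' < norm (z - p)" "ball z (norm (z - p)) \<subseteq> region f i j"
    "1 / c' < norm (w - p)" "ball w (norm (w - p)) \<subseteq> region f j i"
    unfolding q_dir_def less_Sup_iff by auto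
  then show ?thesis
    using that[of "z - p" "w - p"] by simp
qed

text \<open>The condition on \<open>y\<close> describes the ball of radius \<open>1 / c\<close> that
  touches \<open>p\<close> in direction \<open>u\<close>; it is contained in the larger tangent ball
  of radius \<open>norm a\<close>.\<close>

lemma mem_ball_if_tangent:
  fixes u :: "'a::real_inner"
  assumes u: "norm u = 1" and a: "a = norm a *\<^sub>R u" "norm a > 1 / c" and c: "c > 0"
    and y: "c * (norm y)\<^sup>2 < 2 * (y \<bullet> u)"
  shows "p + y \<in> ball (p + a) (norm a)"
proof -
  let ?r = "norm a"
  have "(norm y)\<^sup>2 < 1 / c * (2 * (y \<bullet> u))"
    using y c by (simp add: field_simps)
  also have "\<dots> \<le> ?r * (2 * (y \<bullet> u))"
  proof (rule mult_right_mono)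
    have "0 \<le> c * (norm y)\<^sup>2"
      using c by simp
    then show "0 \<le> 2 * (y \<bullet> u)"
      using y by linarith
  qed (use a in simp)
  finally have lt: "(norm y)\<^sup>2 < 2 * ?r * (y \<bullet> u)"
    by simp
  have "(norm (y - a))\<^sup>2 = (norm y)\<^sup>2 - 2 * (y \<bullet> a) + ?r\<^sup>2"
    by (simp add: power2_norm_eq_inner algebra_simps inner_commute)
  moreover have "y \<bullet> a = ?r * (y \<bullet> u)"
    by (subst a(1)) simp
  ultimately have "(norm (y - a))\<^sup>2 < ?r\<^sup>2"
    using lt by simp
  then have "norm (y - a) < ?r"
    by (rule power2_less_imp_less) simp
  then show ?thesis
    by (simp add: dist_norm norm_minus_commute)
qed

text \<open>The two balls touching the boundary at the nearest adversarial point \<open>x0 + r\<close> have their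
  centres on the line through \<open>x0\<close>: the one in the adversarial region is disjoint from
  \<open>ball x0 (norm r)\<close>, and the two balls are disjoint from each other. Written with the curvature \<open>c\<close>
  instead of the radius \<open>1 / c\<close>, membership in these balls also makes sense for \<open>c = 0\<close>.\<close>

lemma tangent_balls_at_nearest_point:
  fixes f :: "nat \<Rightarrow> 'a::euclidean_space \<Rightarrow> real"
  assumes cont: "continuous_on UNIV (f k)" "continuous_on UNIV (f khat)"
    and r: "r \<noteq> 0" "f khat (x0 + r) \<le> f k (x0 + r)"
    and min: "\<And>y. f khat (x0 + y) \<le> f k (x0 + y) \<Longrightarrow> norm r \<le> norm y"
    and c: "curv f k khat = ereal c" "c \<ge> 0"
  defines "n \<equiv> r /\<^sub>R norm r"
  shows "c * (norm y)\<^sup>2 + 2 * (y \<bullet> n) < 0 \<Longrightarrow> f k (x0 + r + y) < f khat (x0 + r + y)"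
    and "c * (norm y)\<^sup>2 < 2 * (y \<bullet> n) \<Longrightarrow> f khat (x0 + r + y) < f k (x0 + r + y)"
proof -
  let ?p = "x0 + r"
  have n: "norm n = 1" "norm r *\<^sub>R n = r"
    using r(1) by (simp_all add: n_def)
  have x0ball: "ball x0 (norm r) \<subseteq> region f khat k"
  proof
    fix x assume "x \<in> ball x0 (norm r)"
    then have "\<not> norm r \<le> norm (x - x0)"
      by (simp add: dist_norm norm_minus_commute)
    then have "\<not> f khat (x0 + (x - x0)) \<le> f k (x0 + (x - x0))"
      using min by blast
    then show "x \<in> region f khat k"
      by (simp add: region_def)
  qed
  \<comment> \<open>Class \<open>khat\<close> wins throughout the open ball around
    \<open>x0\<close>, so by continuity \<open>f k \<le> f khat\<close> at the touching point; the
    reverse inequality is given.\<close>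
  have p: "?p \<in> dboundary f k khat"
  proof -
    have "closed {x. f k x \<le> f khat x}"
      using cont by (intro closed_Collect_le) auto
    moreover have "ball x0 (norm r) \<subseteq> {x. f k x \<le> f khat x}"
      using x0ball by (auto simp: region_def)
    ultimately have "closure (ball x0 (norm r)) \<subseteq> {x. f k x \<le> f khat x}"
      by (rule closure_minimal[rotated])
    moreover have "?p \<in> closure (ball x0 (norm r))"
      using r(1) by (simp add: dist_norm)
    ultimately show ?thesis
      using r(2) by (auto simp: dboundary_def)
  qed
  have balls: "\<exists>a b. a = norm a *\<^sub>R n \<and> norm a > 1 / c' \<and> ball (?p + a) (norm a) \<subseteq> region f k khat \<and>
      b = norm b *\<^sub>R (- n) \<and> norm b > 1 / c' \<and> ball (?p + b) (norm b) \<subseteq> region f khat k" if "c < c'" for c'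
  proof -
    obtain a b where ab: "norm a > 1 / c'" "ball (?p + a) (norm a) \<subseteq> region f k khat"
      "norm b > 1 / c'" "ball (?p + b) (norm b) \<subseteq> region f khat k"
      using ball_in_region_at_boundary[OF p c(1) \<open>c < c'\<close>] by blast
    have "1 / c' > 0"
      using c(2) that by simp
    then have pos: "a \<noteq> 0" "b \<noteq> 0"
      using ab by auto
    have disj: "region f k khat \<inter> region f khat k = {}"
      by (auto simp: region_def)
    \<comment> \<open>The ball around \<open>x0\<close> is rewritten as a ball touching
      \<open>?p\<close> with centre offset \<open>- r\<close>.\<close>
    have "ball (?p + a) (norm a) \<inter> ball (?p + - r) (norm (- r)) = {}"
      using ab(2) x0ball disj by auto
    then have "norm a *\<^sub>R (- r) = - (norm (- r) *\<^sub>R a)"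
      using pos r(1) by (intro disjoint_balls_opposite_centres) auto
    then have "norm r *\<^sub>R a = norm a *\<^sub>R r"
      by simp
    also have "\<dots> = norm r *\<^sub>R (norm a *\<^sub>R n)"
      by (metis n(2) scaleR_left_commute)
    finally have a: "a = norm a *\<^sub>R n"
      using r(1) by (metis norm_eq_zero scaleR_cancel_left)
    have "ball (?p + a) (norm a) \<inter> ball (?p + b) (norm b) = {}"
      using ab disj by blast
    then have "norm a *\<^sub>R b = - (norm b *\<^sub>R a)"
      using pos by (intro disjoint_balls_opposite_centres)
    also have "\<dots> = norm a *\<^sub>R (norm b *\<^sub>R (- n))"
      by (metis a scaleR_left_commute scaleR_minus_right)
    finally have b: "b = norm b *\<^sub>R (- n)"
      using pos by (metis norm_eq_zero scaleR_cancel_left)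
    from a b ab show ?thesis
      by blast
  qed
  \<comment> \<open>A strict inequality survives a small increase of \<open>c\<close>, so the
    possibly unattained suprema cost nothing in the conclusion.\<close>
  have slack: "\<exists>c'>c. c' * (norm y)\<^sup>2 < s" if "c * (norm y)\<^sup>2 < s" for s
  proof (cases "y = 0")
    case True
    then show ?thesis
      using that by (intro exI[of _ "c + 1"]) simp
  next
    case False
    then have "c < s / (norm y)\<^sup>2"
      using that by (simp add: field_simps)
    then obtain c' where "c < c'" "c' < s / (norm y)\<^sup>2"
      using dense by blast
    then show ?thesis
      using False by (auto simp: field_simps)
  qed
  show "f k (?p + y) < f khat (?p + y)" if y: "c * (norm y)\<^sup>2 + 2 * (y \<bullet> n) < 0"
  proof -
    obtain c' where c': "c' > c" "c' * (norm y)\<^sup>2 < 2 * (y \<bullet> (- n))"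
      using slack[of "2 * (y \<bullet> (- n))"] y by auto
    then obtain b where "b = norm b *\<^sub>R (- n)" "norm b > 1 / c'" "ball (?p + b) (norm b) \<subseteq> region f khat k"
      using balls by blast
    then have "?p + y \<in> region f khat k"
      using mem_ball_if_tangent[of "- n" b c' y ?p] n c' c(2) by auto
    then show ?thesis
      by (simp add: region_def)
  qed
  show "f khat (?p + y) < f k (?p + y)" if y: "c * (norm y)\<^sup>2 < 2 * (y \<bullet> n)"
  proof -
    obtain c' where c': "c' > c" "c' * (norm y)\<^sup>2 < 2 * (y \<bullet> n)"
      using slack y by blast
    then obtain a where "a = norm a *\<^sub>R n" "norm a > 1 / c'" "ball (?p + a) (norm a) \<subseteq> region f k khat"
      using balls by blast
    then have "?p + y \<in> region f k khat"
      using mem_ball_if_tangent[of n a c' y ?p] n c' c(2) by auto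
    then show ?thesis
      by (simp add: region_def)
  qed
qed

text \<open>The adversarial set is closed by continuity and nonempty because the infimum is finite,
  so it has a point nearest to the origin.\<close>

lemma advnorm_UNIV_attained:
  fixes f :: "nat \<Rightarrow> 'a::euclidean_space \<Rightarrow> real"
  assumes cont: "continuous_on UNIV (f k)" "continuous_on UNIV (f khat)"
    and fin: "advnorm f khat k x0 UNIV < \<infinity>"
  obtains r where "advnorm f khat k x0 UNIV = ereal (norm r)" "f khat (x0 + r) \<le> f k (x0 + r)"
    "\<And>y. f khat (x0 + y) \<le> f k (x0 + y) \<Longrightarrow> norm r \<le> norm y"
proof -
  let ?F = "{r. f khat (x0 + r) \<le> f k (x0 + r)}"
  have shift: "continuous_on UNIV (\<lambda>r. x0 + r)"
    by (intro continuous_intros)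
  have "closed ?F"
    by (intro closed_Collect_le continuous_on_compose2[OF cont(1) shift]
        continuous_on_compose2[OF cont(2) shift]) auto
  moreover have "?F \<noteq> {}"
  proof
    assume "?F = {}"
    then have "{ereal (norm r) |r. r \<in> UNIV \<and> f khat (x0 + r) \<le> f k (x0 + r)} = {}"
      by blast
    then show False
      using fin unfolding advnorm_def by (simp add: top_ereal_def)
  qed
  ultimately obtain r where r: "r \<in> ?F" "\<And>y. y \<in> ?F \<Longrightarrow> dist 0 r \<le> dist 0 y"
    using distance_attains_inf by metis
  have "advnorm f khat k x0 UNIV = ereal (norm r)"
    unfolding advnorm_def
  proof (rule antisym)
    show "Inf {ereal (norm r) |r. r \<in> UNIV \<and> f khat (x0 + r) \<le> f k (x0 + r)} \<le> ereal (norm r)"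
      using r(1) by (intro Inf_lower) auto
    show "ereal (norm r) \<le> Inf {ereal (norm r) |r. r \<in> UNIV \<and> f khat (x0 + r) \<le> f k (x0 + r)}"
      using r(2) by (intro Inf_greatest) auto
  qed
  then show ?thesis
    using that r by auto
qed

section \<open>Robustness to random subspace perturbations\<close>

text \<open>With \<open>y = sqrt (ln (1 / \<delta>) / m)\<close>, the inverse
  \<open>1 + 2 * y + 2 * y ^ 2\<close> is the quadratic Taylor polynomial of
  \<open>exp (2 * y)\<close>. Its logarithm is therefore at most \<open>2 * y\<close>, which leaves
  \<open>2 * y ^ 2\<close> in the exponent.\<close>

lemma inverse_zeta1_tail:
  assumes m: "1 \<le> m" and \<delta>: "0 < \<delta>" "\<delta> < 1"
  shows "1 \<le> inverse (zeta1 m \<delta>)"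
    and "exp (- (real m / 2 * (inverse (zeta1 m \<delta>) - 1 - ln (inverse (zeta1 m \<delta>))))) \<le> \<delta>"
proof -
  define y where "y = sqrt (ln (1 / \<delta>) / real m)"
  have L: "ln (1 / \<delta>) / real m \<ge> 0"
    using m \<delta> by simp
  then have y: "y \<ge> 0" "y\<^sup>2 = ln (1 / \<delta>) / real m"
    by (simp_all add: y_def)
  have inv: "inverse (zeta1 m \<delta>) = 1 + 2 * y + 2 * y\<^sup>2"
    by (simp add: zeta1_def y(2)) (simp add: y_def)
  then show ge1: "1 \<le> inverse (zeta1 m \<delta>)"
    using y(1) zero_le_power2[of y] by linarith
  have "1 + 2 * y + (2 * y)\<^sup>2 / 2 \<le> exp (2 * y)"
    using y by (intro exp_lower_Taylor_quadratic) simp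
  then have "inverse (zeta1 m \<delta>) \<le> exp (2 * y)"
    by (simp add: inv power2_eq_square)
  then have "ln (inverse (zeta1 m \<delta>)) \<le> ln (exp (2 * y))"
    using ge1 by (intro ln_mono less_le_trans[OF zero_less_one])
  then have "ln (inverse (zeta1 m \<delta>)) \<le> 2 * y"
    by simp
  then have "real m * y\<^sup>2 \<le> real m / 2 * (inverse (zeta1 m \<delta>) - 1 - ln (inverse (zeta1 m \<delta>)))"
    using inv mult_left_mono[of "2 * y\<^sup>2" "inverse (zeta1 m \<delta>) - 1 - ln (inverse (zeta1 m \<delta>))" "real m / 2"]
    by simp
  moreover have "real m * y\<^sup>2 = - ln \<delta>"
    using m \<delta> y(2) by (simp add: ln_div)
  ultimately have "exp (- (real m / 2 * (inverse (zeta1 m \<delta>) - 1 - ln (inverse (zeta1 m \<delta>))))) \<le> exp (ln \<delta>)"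
    by simp
  then show "exp (- (real m / 2 * (inverse (zeta1 m \<delta>) - 1 - ln (inverse (zeta1 m \<delta>))))) \<le> \<delta>"
    using \<delta> by simp
qed

text \<open>The difference of the two sides vanishes at 0 and has derivative
  \<open>x * (1 - exp x)\<close>. This handles the square root branch of
  \<open>zeta2\<close>.\<close>

lemma one_minus_mult_exp_le:
  fixes u :: real
  assumes "0 \<le> u"
  shows "(1 - u) * exp u \<le> 1 - u\<^sup>2 / 2"
proof -
  let ?g = "\<lambda>u. (1 - u) * exp u - (1 - u\<^sup>2 / 2)"
  have "?g u \<le> ?g 0"
  proof (rule DERIV_nonpos_imp_nonincreasing[OF assms])
    fix x :: real assume "0 \<le> x" "x \<le> u"
    have "(?g has_real_derivative (x * (1 - exp x))) (at x)"
      by (auto intro!: derivative_eq_intros simp: algebra_simps)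
    moreover have "x * (1 - exp x) \<le> 0"
      using \<open>0 \<le> x\<close> by (simp add: mult_nonneg_nonpos)
    ultimately show "\<exists>y. (?g has_real_derivative y) (at x) \<and> y \<le> 0"
      by blast
  qed
  then show ?thesis
    by simp
qed

text \<open>The tail bound amounts to
  \<open>\<tau> * exp (1 - \<tau>) \<le> \<delta> powr (2 / m)\<close>, which holds in either branch
  of the maximum: in the first by dropping \<open>exp (- \<tau>)\<close>, in the second by the
  preceding inequality with \<open>u = 1 - \<tau>\<close>.\<close>

lemma inverse_zeta2_tail:
  assumes m: "1 \<le> m" and \<delta>: "0 < \<delta>" "\<delta> < 1"
  shows "0 < inverse (zeta2 m \<delta>)" and "inverse (zeta2 m \<delta>) \<le> 1"
    and "exp (- (real m / 2 * (inverse (zeta2 m \<delta>) - 1 - ln (inverse (zeta2 m \<delta>))))) \<le> \<delta>"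
proof -
  define \<eta> where "\<eta> = \<delta> powr (2 / real m)"
  define u where "u = sqrt (2 * (1 - \<eta>))"
  define \<tau> where "\<tau> = inverse (zeta2 m \<delta>)"
  have \<eta>: "0 < \<eta>" "\<eta> < 1"
    using m \<delta> powr_less_mono2[of "2 / real m" \<delta> 1] by (simp_all add: \<eta>_def)
  have u: "0 \<le> u" "u\<^sup>2 / 2 = 1 - \<eta>"
    using \<eta> by (simp_all add: u_def)
  have \<tau>: "\<tau> = max (exp (- 1) * \<eta>) (1 - u)"
    by (simp add: \<tau>_def zeta2_def \<eta>_def u_def)
  have e: "exp (- 1) * \<eta> < 1"
    using \<eta> mult_strict_mono[of "exp (- 1)" 1 \<eta> 1] by simp
  have pos: "\<tau> > 0"
    using \<eta> by (simp add: \<tau> less_max_iff_disj)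
  then show "0 < inverse (zeta2 m \<delta>)"
    by (simp add: \<tau>_def)
  show "inverse (zeta2 m \<delta>) \<le> 1"
    unfolding \<tau>_def[symmetric] using e u by (simp add: \<tau>)
  have "\<tau> * exp (1 - \<tau>) \<le> \<eta>"
  proof (cases "1 - u \<le> exp (- 1) * \<eta>")
    case True
    then have t: "\<tau> = exp (- 1) * \<eta>"
      by (simp add: \<tau>)
    have "\<tau> * exp (1 - \<tau>) \<le> \<tau> * exp 1"
      using pos by simp
    also have "\<dots> = \<eta>"
      by (simp add: t exp_minus)
    finally show ?thesis .
  next
    case False
    then have "\<tau> = 1 - u"
      by (simp add: \<tau>)
    then show ?thesis
      using one_minus_mult_exp_le[OF u(1)] u(2) by simp
  qed
  then have "ln (\<tau> * exp (1 - \<tau>)) \<le> ln \<eta>"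
    using pos \<eta> by (intro ln_mono) auto
  then have "ln \<tau> + (1 - \<tau>) \<le> 2 / real m * ln \<delta>"
    using pos \<delta> by (simp add: ln_mult \<eta>_def ln_powr)
  then have "real m / 2 * (ln \<tau> + (1 - \<tau>)) \<le> real m / 2 * (2 / real m * ln \<delta>)"
    by (intro mult_left_mono) auto
  then have "- (real m / 2 * (\<tau> - 1 - ln \<tau>)) \<le> ln \<delta>"
    using m by (simp add: field_simps)
  then have "exp (- (real m / 2 * (\<tau> - 1 - ln \<tau>))) \<le> exp (ln \<delta>)"
    by simp
  then show "exp (- (real m / 2 * (inverse (zeta2 m \<delta>) - 1 - ln (inverse (zeta2 m \<delta>))))) \<le> \<delta>"
    using \<delta> by (simp add: \<tau>_def)
qed

text \<open>In the next two lemmas \<open>\<rho>\<close> is the length of the minimal perturbation, \<open>t\<close> that of a perturbation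
  in the subspace and \<open>h\<close> (or \<open>t * s\<close>) its component along the minimal one; \<open>c\<close> is the curvature,
  \<open>Z = \<zeta>\<^sub>2 d / m\<close>, and \<open>\<sigma>\<close> bounds the cosine of the angle between the minimal perturbation and the
  subspace. The hypothesis \<open>ge\<close> (the conclusion) says that the perturbed point is outside (inside) the
  ball touching the boundary at the nearest adversarial point.\<close>

lemma adversarial_norm_lower_bound:
  fixes c \<rho> \<sigma> Z t h :: real
  assumes \<sigma>: "\<sigma> > 0" "1 \<le> Z * \<sigma>\<^sup>2" and c: "c \<ge> 0" and \<rho>: "\<rho> > 0" and Z: "Z \<ge> 1" "c * \<rho> * Z \<le> 0.2"
    and t: "t \<ge> 0" and h: "h \<le> \<sigma> * t"
    and ge: "c * (t\<^sup>2 - 2 * \<rho> * h + \<rho>\<^sup>2) + 2 * (h - \<rho>) \<ge> 0"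
  shows "(1 - 0.625 * c * \<rho> * Z) * \<rho> / \<sigma> \<le> t"
proof (rule ccontr)
  define w \<epsilon> \<theta> where "w = c * \<rho> * Z" and "\<epsilon> = c * \<rho>" and "\<theta> = 1 - 0.625 * w"
  assume "\<not> ?thesis"
  then have "t < \<theta> * \<rho> / \<sigma>"
    by (simp add: \<theta>_def w_def mult.assoc)
  then have st: "\<sigma> * t < \<theta> * \<rho>"
    using \<sigma> by (simp add: field_simps)
  have w: "0 \<le> w" "w \<le> 0.2"
    using c \<rho> Z by (simp_all add: w_def)
  have \<epsilon>: "0 \<le> \<epsilon>" "\<epsilon> \<le> w"
    using c \<rho> Z mult_left_mono[of 1 Z "c * \<rho>"] by (simp_all add: w_def \<epsilon>_def)
  have \<theta>: "0.875 \<le> \<theta>" "\<theta> \<le> 1"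
    using w by (simp_all add: \<theta>_def)
  have "t\<^sup>2 \<le> Z * \<sigma>\<^sup>2 * t\<^sup>2"
    using mult_right_mono[OF \<sigma>(2), of "t\<^sup>2"] by simp
  also have "\<dots> = Z * (\<sigma> * t)\<^sup>2"
    by (simp add: power_mult_distrib)
  also have "\<dots> \<le> Z * (\<theta> * \<rho>)\<^sup>2"
    using Z st \<sigma> t by (intro mult_left_mono power_mono) auto
  also have "\<dots> \<le> Z * \<rho>\<^sup>2"
    using Z \<theta> \<rho> by (intro mult_left_mono power_mono) (auto simp: mult_le_cancel_right1)
  finally have "c * t\<^sup>2 \<le> c * (Z * \<rho>\<^sup>2)"
    using c by (rule mult_left_mono)
  also have "\<dots> = w * \<rho>"
    by (simp add: w_def power2_eq_square)
  finally have ct: "c * t\<^sup>2 \<le> w * \<rho>" .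
  \<comment> \<open>Collecting terms in \<open>ge\<close> gives \<open>h\<close> the coefficient
    \<open>2 * (1 - \<epsilon>)\<close>, which is positive as
    \<open>\<epsilon> \<le> w \<le> 0.2\<close>.\<close>
  have "(1 - \<epsilon>) * h \<le> (1 - \<epsilon>) * (\<sigma> * t)"
    using \<epsilon> w h by (intro mult_left_mono) auto
  also have "\<dots> < (1 - \<epsilon>) * (\<theta> * \<rho>)"
    using \<epsilon> w st by (intro mult_strict_left_mono) auto
  finally have hh: "(1 - \<epsilon>) * h < (1 - \<epsilon>) * \<theta> * \<rho>"
    by simp
  have "0 \<le> c * t\<^sup>2 + 2 * ((1 - \<epsilon>) * h) + \<epsilon> * \<rho> - 2 * \<rho>"
    using ge by (simp add: \<epsilon>_def algebra_simps power2_eq_square)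
  also have "\<dots> < w * \<rho> + 2 * ((1 - \<epsilon>) * \<theta> * \<rho>) + \<epsilon> * \<rho> - 2 * \<rho>"
    using ct hh by linarith
  also have "\<dots> = (w + 2 * (1 - \<epsilon>) * \<theta> + \<epsilon> - 2) * \<rho>"
    by (simp add: algebra_simps)
  finally have "0 < w + 2 * (1 - \<epsilon>) * \<theta> + \<epsilon> - 2"
    using \<rho> by (simp add: zero_less_mult_iff)
  also have "\<dots> = w + 2 * \<theta> - 2 * (\<epsilon> * \<theta>) + \<epsilon> - 2"
    by (simp add: algebra_simps)
  \<comment> \<open>Here \<open>w + 2 * \<theta> - 2 = - 0.25 * w\<close>. Since
    \<open>\<theta> \<ge> 1 - 0.625 * 0.2 = 0.875\<close>, the left side is at least
    \<open>1.75 * \<epsilon>\<close>, a contradiction.\<close>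
  finally have "2 * (\<epsilon> * \<theta>) < \<epsilon> - 0.25 * w"
    by (simp add: \<theta>_def)
  moreover have "\<epsilon> * 0.875 \<le> \<epsilon> * \<theta>"
    using \<epsilon> \<theta> by (intro mult_left_mono) auto
  ultimately show False
    using \<epsilon> w by simp
qed

lemma adversarial_norm_upper_bound:
  fixes c \<rho> \<sigma> Z s t :: real
  assumes \<sigma>: "\<sigma> > 0" "Z * \<sigma>\<^sup>2 = 1" and c: "c \<ge> 0" and \<rho>: "\<rho> > 0" and Z: "c * \<rho> * Z \<le> 0.2" and s: "s > \<sigma>"
    and t: "t = (1 + 2.25 * c * \<rho> * Z) * \<rho> / \<sigma>"
  shows "c * (t\<^sup>2 - 2 * \<rho> * (t * s) + \<rho>\<^sup>2) < 2 * (t * s - \<rho>)"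
proof -
  define w \<epsilon> \<theta> where "w = c * \<rho> * Z" and "\<epsilon> = c * \<rho>" and "\<theta> = 1 + 2.25 * w"
  have tt: "t * \<sigma> = \<theta> * \<rho>"
    using \<sigma> by (simp add: t \<theta>_def w_def mult.assoc)
  have Z0: "Z > 0"
    using zero_less_mult_pos2[of Z "\<sigma>\<^sup>2"] \<sigma> by simp
  then have w: "0 \<le> w" "w \<le> 0.2"
    using c \<rho> Z by (simp_all add: w_def)
  have \<epsilon>: "0 \<le> \<epsilon>"
    using c \<rho> by (simp add: \<epsilon>_def)
  have \<theta>: "1 \<le> \<theta>" "\<theta> \<le> 1.45"
    using w by (simp_all add: \<theta>_def)
  have "t\<^sup>2 = Z * (t * \<sigma>)\<^sup>2"
    using \<sigma>(2) by (simp add: power_mult_distrib mult.left_commute)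
  then have "c * t\<^sup>2 = w * \<theta>\<^sup>2 * \<rho>"
    by (simp add: tt w_def power2_eq_square)
  moreover have "\<theta>\<^sup>2 \<le> 1.45\<^sup>2"
    using \<theta> by (intro power_mono) auto
  then have "w * \<theta>\<^sup>2 \<le> w * 2.1025"
    using w by (intro mult_left_mono) (auto simp: power2_eq_square)
  then have "w * \<theta>\<^sup>2 * \<rho> \<le> w * 2.1025 * \<rho>"
    using \<rho> by (intro mult_right_mono) auto
  ultimately have ct: "c * t\<^sup>2 \<le> w * 2.1025 * \<rho>"
    by simp
  have "t > 0"
    using tt \<sigma> \<theta> \<rho> by (metis less_le_trans mult_pos_pos zero_less_mult_pos2 zero_less_one)
  then have "\<theta> * \<rho> < t * s"
    using s tt by (metis mult_strict_left_mono)
  then have "(1 + \<epsilon>) * (\<theta> * \<rho>) < (1 + \<epsilon>) * (t * s)"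
    using \<epsilon> by (intro mult_strict_left_mono) auto
  \<comment> \<open>The term \<open>2 * \<theta> = 2 + 4.5 * w\<close> absorbs
    \<open>2.1025 * w\<close>, where \<open>2.1025 = 1.45 ^ 2\<close> and
    \<open>1.45 = 1 + 2.25 * 0.2\<close> bounds \<open>\<theta>\<close>.\<close>
  moreover have "(w * 2.1025 + \<epsilon> + 2) * \<rho> \<le> 2 * ((1 + \<epsilon>) * \<theta>) * \<rho>"
  proof (rule mult_right_mono)
    have "\<epsilon> * 1 \<le> \<epsilon> * \<theta>"
      using \<epsilon> \<theta> by (intro mult_left_mono) auto
    then show "w * 2.1025 + \<epsilon> + 2 \<le> 2 * ((1 + \<epsilon>) * \<theta>)"
      using w \<epsilon> by (simp add: distrib_right) (simp add: \<theta>_def)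
  qed (use \<rho> in simp)
  ultimately have "w * 2.1025 * \<rho> + \<epsilon> * \<rho> + 2 * \<rho> < 2 * ((1 + \<epsilon>) * (t * s))"
    by (simp add: algebra_simps)
  then have "c * t\<^sup>2 + \<epsilon> * \<rho> + 2 * \<rho> < 2 * (t * s) + 2 * (\<epsilon> * (t * s))"
    using ct by (simp add: distrib_right)
  then show ?thesis
    by (simp add: \<epsilon>_def algebra_simps power2_eq_square)
qed

text \<open>For the lower bound, every adversarial \<open>y\<close> in \<open>S\<close> avoids the
  ball on the \<open>khat\<close> side, and Cauchy-Schwarz limits its component along the minimal
  perturbation. For the upper bound, one vector of \<open>S\<close> along the projected direction
  reaches the ball on the \<open>k\<close> side.\<close>

lemma advnorm_subspace_bounds:
  fixes f :: "nat \<Rightarrow> 'a::euclidean_space \<Rightarrow> real"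
  assumes cont: "continuous_on UNIV (f k)" "continuous_on UNIV (f khat)"
    and r: "r \<noteq> 0" "f khat (x0 + r) \<le> f k (x0 + r)"
    and min: "\<And>y. f khat (x0 + y) \<le> f k (x0 + y) \<Longrightarrow> norm r \<le> norm y"
    and c: "curv f k khat = ereal c" "c \<ge> 0"
    and Z: "Z \<ge> 1" "c * norm r * Z \<le> 0.2"
    and S: "subspace S"
    and \<sigma>1: "\<sigma>1 > 0" "1 \<le> Z * \<sigma>1\<^sup>2" "1 - (infdist (r /\<^sub>R norm r) S)\<^sup>2 \<le> \<sigma>1\<^sup>2"
    and \<sigma>2: "\<sigma>2 > 0" "Z * \<sigma>2\<^sup>2 = 1" "1 - (infdist (r /\<^sub>R norm r) S)\<^sup>2 > \<sigma>2\<^sup>2"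
  shows "ereal ((1 - 0.625 * c * norm r * Z) * norm r / \<sigma>1) \<le> advnorm f khat k x0 S"
    and "advnorm f khat k x0 S \<le> ereal ((1 + 2.25 * c * norm r * Z) * norm r / \<sigma>2)"
proof -
  define n where "n = r /\<^sub>R norm r"
  have n: "norm n = 1" "r = norm r *\<^sub>R n"
    using r(1) by (simp_all add: n_def)
  note tangent = tangent_balls_at_nearest_point[OF cont r min c, folded n_def]
  obtain P where P: "\<And>x. P x \<in> S" "\<And>x y. y \<in> S \<Longrightarrow> (x - P x) \<bullet> y = 0"
    using subspace_orthogonal_projection[OF S] by metis
  define s where "s = norm (P n)"
  have "infdist n S = norm (n - P n)"
    using P S by (intro infdist_subspace_eq_norm)
  moreover have "(norm n)\<^sup>2 = (norm (P n))\<^sup>2 + (norm (n - P n))\<^sup>2"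
    using norm_add_Pythagorean[of "P n" "n - P n"] P by (simp add: orthogonal_def inner_commute)
  ultimately have s: "s\<^sup>2 = 1 - (infdist n S)\<^sup>2"
    by (simp add: s_def n)
  \<comment> \<open>The tangent balls are described relative to the touching point, so a
    perturbation \<open>y\<close> of \<open>x0\<close> enters them as \<open>y - r\<close>.\<close>
  have expand: "(norm (y - r))\<^sup>2 = (norm y)\<^sup>2 - 2 * norm r * (y \<bullet> n) + (norm r)\<^sup>2"
      "(y - r) \<bullet> n = y \<bullet> n - norm r" for y
  proof -
    have "y \<bullet> r = norm r * (y \<bullet> n)" "r \<bullet> n = norm r"
      using n(1) by (subst n(2), simp add: norm_eq_1)+
    then show "(norm (y - r))\<^sup>2 = (norm y)\<^sup>2 - 2 * norm r * (y \<bullet> n) + (norm r)\<^sup>2"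
      "(y - r) \<bullet> n = y \<bullet> n - norm r"
      by (simp_all add: power2_norm_eq_inner inner_diff_left inner_diff_right inner_commute)
  qed
  show "ereal ((1 - 0.625 * c * norm r * Z) * norm r / \<sigma>1) \<le> advnorm f khat k x0 S"
    unfolding advnorm_def
  proof (rule Inf_greatest, clarify)
    fix y assume y: "y \<in> S" "f khat (x0 + y) \<le> f k (x0 + y)"
    have "y \<bullet> n = y \<bullet> P n"
      using P(2)[OF y(1), of n] by (simp add: inner_diff_left inner_commute[of y])
    also have "\<dots> \<le> norm y * s"
      unfolding s_def by (rule norm_cauchy_schwarz)
    also have "\<dots> \<le> norm y * \<sigma>1"
    proof (rule mult_left_mono)
      show "s \<le> \<sigma>1"
        by (rule power2_le_imp_le) (use s \<sigma>1 in \<open>simp_all add: n_def\<close>)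
    qed simp
    finally have "y \<bullet> n \<le> \<sigma>1 * norm y"
      by (simp add: mult.commute)
    moreover have "0 \<le> c * (norm (y - r))\<^sup>2 + 2 * ((y - r) \<bullet> n)"
      using tangent(1)[of "y - r"] y(2) by fastforce
    ultimately have "(1 - 0.625 * c * norm r * Z) * norm r / \<sigma>1 \<le> norm y"
      using \<sigma>1 c Z r(1) by (intro adversarial_norm_lower_bound[where h = "y \<bullet> n"]) (auto simp: expand)
    then show "ereal ((1 - 0.625 * c * norm r * Z) * norm r / \<sigma>1) \<le> ereal (norm y)"
      by simp
  qed
  define t where "t = (1 + 2.25 * c * norm r * Z) * norm r / \<sigma>2"
  have "s > \<sigma>2"
    by (rule power2_less_imp_less) (use s \<sigma>2 in \<open>simp_all add: n_def s_def\<close>)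
  have s0: "s > 0"
    using \<open>s > \<sigma>2\<close> \<sigma>2 by simp
  \<comment> \<open>Since \<open>norm (P n) = s\<close>, this vector has length \<open>t\<close>;
    its direction maximises the component along \<open>n\<close> within \<open>S\<close>.\<close>
  define y where "y = (t / s) *\<^sub>R P n"
  have "t \<ge> 0"
    using c Z \<sigma>2 by (simp add: t_def)
  then have normy: "norm y = t"
    using s0 by (simp add: y_def s_def)
  have "P n \<bullet> n = s\<^sup>2"
    using P(2)[OF P(1), of n n] by (simp add: inner_diff_left s_def power2_norm_eq_inner inner_commute[of n])
  then have yn: "y \<bullet> n = t * s"
    using s0 by (simp add: y_def power2_eq_square)
  have "c * (t\<^sup>2 - 2 * norm r * (t * s) + (norm r)\<^sup>2) < 2 * (t * s - norm r)"
    using \<sigma>2 c Z r(1) \<open>s > \<sigma>2\<close> by (intro adversarial_norm_upper_bound) (auto simp: t_def)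
  then have "c * (norm (y - r))\<^sup>2 < 2 * ((y - r) \<bullet> n)"
    unfolding expand[of y] normy yn .
  then have "f khat (x0 + r + (y - r)) < f k (x0 + r + (y - r))"
    using tangent(2)[of "y - r"] by blast
  moreover have "y \<in> S"
    unfolding y_def using S P(1) by (rule subspace_scale)
  ultimately have "advnorm f khat k x0 S \<le> ereal (norm y)"
    unfolding advnorm_def by (intro Inf_lower) auto
  then show "advnorm f khat k x0 S \<le> ereal ((1 + 2.25 * c * norm r * Z) * norm r / \<sigma>2)"
    by (simp add: normy t_def)
qed

theorem theorem2:
  fixes f :: "nat \<Rightarrow> 'a::euclidean_space \<Rightarrow> real"
    and L khat k m :: nat and \<delta> :: real and x0 :: 'a
  defines "r \<equiv> advnorm f khat k x0 UNIV"
    and "\<kappa> \<equiv> curv f k khat"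
  assumes "DIM('a) \<ge> 2" and "1 \<le> m" and "m < DIM('a)"
    and "0 < \<delta>" and "\<delta> < 1"
    and "khat < L" and "k < L" and "k \<noteq> khat"
    and "\<forall>i<L. continuous_on UNIV (f i)"
    and "\<forall>i<L. \<forall>j<L. i \<noteq> j \<longrightarrow> smooth_hypersurface (dboundary f i j)"
    and "\<forall>j<L. j \<noteq> khat \<longrightarrow> f j x0 < f khat x0"
    and "r < \<infinity>"
    and "\<kappa> \<le> ereal (0.2 / (zeta2 m \<delta> * real_of_ereal r) * (real m / real DIM('a)))"
  shows "\<exists>A\<in>sets (rand_vectors m). prob_space.prob (rand_vectors m) A \<ge> 1 - 4 * \<delta> \<and>
           A \<subseteq> {vs \<in> space (rand_vectors m).
             ereal ((1 - 0.625 * real_of_ereal r * real_of_ereal \<kappa> * zeta2 m \<delta> * (real DIM('a) / real m))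
                    * sqrt (zeta1 m \<delta>) * sqrt (real DIM('a) / real m))
               \<le> advnorm f khat k x0 (span (vs ` {..<m})) / r
             \<and> advnorm f khat k x0 (span (vs ` {..<m})) / r
               \<le> ereal ((1 + 2.25 * real_of_ereal r * real_of_ereal \<kappa> * zeta2 m \<delta> * (real DIM('a) / real m))
                    * sqrt (zeta2 m \<delta>) * sqrt (real DIM('a) / real m))}"
proof -
  let ?d = "real DIM('a)"
  let ?R = "rand_vectors m :: (nat \<Rightarrow> 'a) measure"
  interpret R: prob_space ?R
    by (rule prob_space_rand_vectors)
  note m = \<open>1 \<le> m\<close> \<open>m < DIM('a)\<close> and \<delta> = \<open>0 < \<delta>\<close> \<open>\<delta> < 1\<close>
  have cont: "continuous_on UNIV (f k)" "continuous_on UNIV (f khat)"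
    using \<open>\<forall>i<L. continuous_on UNIV (f i)\<close> \<open>k < L\<close> \<open>khat < L\<close> by auto
  obtain r0 where r0: "r = ereal (norm r0)" "f khat (x0 + r0) \<le> f k (x0 + r0)"
    "\<And>y. f khat (x0 + y) \<le> f k (x0 + y) \<Longrightarrow> norm r0 \<le> norm y"
    using advnorm_UNIV_attained[OF cont] \<open>r < \<infinity>\<close> unfolding r_def by metis
  have "f k x0 < f khat x0"
    using \<open>\<forall>j<L. j \<noteq> khat \<longrightarrow> f j x0 < f khat x0\<close> \<open>k < L\<close> \<open>k \<noteq> khat\<close> by blast
  then have r0_nz: "r0 \<noteq> 0"
    using r0(2) by auto
  let ?\<rho> = "norm r0"
  have \<rho>: "?\<rho> > 0"
    using r0_nz by simp
  \<comment> \<open>The assumed bound on \<open>\<kappa>\<close> is a real number, so the curvature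
    is finite.\<close>
  obtain c where c: "\<kappa> = ereal c" "c \<ge> 0"
  proof -
    have "0 \<le> \<kappa>"
      unfolding \<kappa>_def curv_def using q_bd_nonneg[of f k khat] by (simp add: inverse_ereal_ge0I)
    then show ?thesis
      using that \<open>\<kappa> \<le> ereal _\<close> by (cases \<kappa>) auto
  qed
  define \<tau>1 \<tau>2 where "\<tau>1 = inverse (zeta1 m \<delta>)" and "\<tau>2 = inverse (zeta2 m \<delta>)"
  note tail1 = inverse_zeta1_tail[OF m(1) \<delta>, folded \<tau>1_def]
  note tail2 = inverse_zeta2_tail[OF m(1) \<delta>, folded \<tau>2_def]
  define Z where "Z = zeta2 m \<delta> * (?d / real m)"
  \<comment> \<open>The reciprocals of these cosine thresholds are the factors
    \<open>sqrt (zeta1 m \<delta>) * sqrt (d / m)\<close> and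
    \<open>sqrt (zeta2 m \<delta>) * sqrt (d / m)\<close> of the claim.\<close>
  define \<sigma>1 \<sigma>2 where "\<sigma>1 = sqrt (\<tau>1 * real m / ?d)" and "\<sigma>2 = sqrt (\<tau>2 * real m / ?d)"
  have z2: "zeta2 m \<delta> = 1 / \<tau>2" and z1: "zeta1 m \<delta> = 1 / \<tau>1"
    by (simp_all add: \<tau>1_def \<tau>2_def inverse_eq_divide)
  have dm: "?d > 0" "real m > 0" "real m < ?d"
    using m by simp_all
  have \<sigma>1: "\<sigma>1 > 0" "\<sigma>1\<^sup>2 = \<tau>1 * real m / ?d" and \<sigma>2: "\<sigma>2 > 0" "\<sigma>2\<^sup>2 = \<tau>2 * real m / ?d"
    using tail1(1) tail2(1) dm by (simp_all add: \<sigma>1_def \<sigma>2_def)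
  have Z\<sigma>2: "Z * \<sigma>2\<^sup>2 = 1"
    unfolding Z_def \<sigma>2(2) z2 using tail2(1) dm by simp
  have Z\<sigma>1: "Z * \<sigma>1\<^sup>2 = \<tau>1 / \<tau>2"
    unfolding Z_def \<sigma>1(2) z2 using tail2(1) dm by simp
  have Z\<sigma>1_ge: "1 \<le> Z * \<sigma>1\<^sup>2"
    unfolding Z\<sigma>1 using tail1(1) tail2(1,2) by simp
  have Z1: "Z \<ge> 1"
  proof -
    have "Z = (1 / \<tau>2) * (?d / real m)"
      by (simp add: Z_def z2)
    moreover have "1 / \<tau>2 \<ge> 1" "?d / real m \<ge> 1"
      using tail2(1,2) dm by simp_all
    ultimately show ?thesis
      using mult_mono[of 1 "1 / \<tau>2" 1 "?d / real m"] tail2(1) by simp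
  qed
  have cZ: "c * ?\<rho> * Z \<le> 0.2"
  proof -
    have "c \<le> 0.2 / (zeta2 m \<delta> * ?\<rho>) * (real m / ?d)"
      using \<open>\<kappa> \<le> ereal _\<close> by (simp add: c r0(1))
    also have "\<dots> = 0.2 / (?\<rho> * Z)"
      unfolding Z_def using dm by simp
    finally show ?thesis
      using \<rho> Z1 by (simp add: field_simps)
  qed
  define n where "n = r0 /\<^sub>R ?\<rho>"
  have n: "norm n = 1"
    using r0_nz by (simp add: n_def)
  define D where "D v = (infdist n (span (v ` {..<m})))\<^sup>2" for v :: "nat \<Rightarrow> 'a"
  have D_meas [measurable]: "D \<in> borel_measurable ?R"
    unfolding D_def by (intro borel_measurable_power borel_measurable_infdist_span
        borel_measurable_rand_vectors_component borel_measurable_const)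
  let ?bad1 = "{v \<in> space ?R. D v < 1 - \<sigma>1\<^sup>2}" and ?bad2 = "{v \<in> space ?R. 1 - \<sigma>2\<^sup>2 \<le> D v}"
  let ?T = "\<lambda>\<tau>. {v \<in> space ?R. (\<tau> - 1) * (D v - (1 - \<tau> * real m / ?d)) \<le> 0}"
  have bad1: "R.prob ?bad1 \<le> \<delta>"
  proof (cases "\<tau>1 * real m < ?d")
    case True
    have "R.prob ?bad1 \<le> R.prob (?T \<tau>1)"
      using tail1(1) by (intro R.finite_measure_mono) (auto simp: \<sigma>1(2) mult_nonneg_nonpos)
    also have "\<dots> \<le> exp (- (real m / 2 * (\<tau>1 - 1 - ln \<tau>1)))"
      unfolding D_def using tail1(1) True by (intro rand_vectors_distance_tail[OF n m(2)]) auto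
    finally show ?thesis
      using tail1(2) by linarith
  \<comment> \<open>Now the threshold \<open>\<sigma>1\<close> is at least 1, and no cosine can
    exceed it.\<close>
  next
    case False
    then have "1 - \<sigma>1\<^sup>2 \<le> 0"
      using dm by (simp add: \<sigma>1(2))
    then have "?bad1 = {}"
      by (auto simp: D_def not_less intro: order_trans[OF _ zero_le_power2])
    then have "R.prob ?bad1 = 0"
      by (simp only: measure_empty)
    then show ?thesis
      using \<delta> by simp
  qed
  have bad2: "R.prob ?bad2 \<le> \<delta>"
  proof -
    have "\<tau>2 * real m < ?d"
      using mult_right_mono[OF tail2(2), of "real m"] dm by linarith
    have "R.prob ?bad2 \<le> R.prob (?T \<tau>2)"
      using tail2(2) by (intro R.finite_measure_mono) (auto simp: \<sigma>2(2) mult_nonpos_nonneg)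
    also have "\<dots> \<le> exp (- (real m / 2 * (\<tau>2 - 1 - ln \<tau>2)))"
      unfolding D_def using tail2(1) \<open>\<tau>2 * real m < ?d\<close> by (intro rand_vectors_distance_tail[OF n m(2)]) auto
    finally show ?thesis
      using tail2(3) by linarith
  qed
  \<comment> \<open>This event depends only on the measurable distance \<open>D\<close>, so the
    measurability of \<open>advnorm\<close> on the random span is not at issue. Two bad events of
    probability at most \<open>\<delta>\<close> each give \<open>1 - 2 * \<delta>\<close>, hence the
    claimed bound.\<close>
  define A where "A = space ?R - (?bad1 \<union> ?bad2)"
  have bad_sets: "?bad1 \<in> sets ?R" "?bad2 \<in> sets ?R"
    by measurable
  have "R.prob (?bad1 \<union> ?bad2) \<le> 2 * \<delta>"
    using measure_Un_le[OF bad_sets] bad1 bad2 by linarith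
  then have "R.prob A \<ge> 1 - 4 * \<delta>"
    unfolding A_def using bad_sets \<delta> by (subst R.prob_compl) auto
  moreover have "A \<in> sets ?R"
    unfolding A_def using bad_sets by blast
  moreover have "ereal ((1 - 0.625 * real_of_ereal r * real_of_ereal \<kappa> * zeta2 m \<delta> * (?d / real m))
                    * sqrt (zeta1 m \<delta>) * sqrt (?d / real m))
               \<le> advnorm f khat k x0 (span (v ` {..<m})) / r
             \<and> advnorm f khat k x0 (span (v ` {..<m})) / r
               \<le> ereal ((1 + 2.25 * real_of_ereal r * real_of_ereal \<kappa> * zeta2 m \<delta> * (?d / real m))
                    * sqrt (zeta2 m \<delta>) * sqrt (?d / real m))" if "v \<in> A" for v
  proof -
    have v: "1 - \<sigma>1\<^sup>2 \<le> D v" "D v < 1 - \<sigma>2\<^sup>2"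
      using that by (auto simp: A_def)
    have D1: "1 - (infdist (r0 /\<^sub>R ?\<rho>) (span (v ` {..<m})))\<^sup>2 \<le> \<sigma>1\<^sup>2"
      and D2: "1 - (infdist (r0 /\<^sub>R ?\<rho>) (span (v ` {..<m})))\<^sup>2 > \<sigma>2\<^sup>2"
      using v unfolding D_def n_def by linarith+
    note bounds = advnorm_subspace_bounds[OF cont r0_nz r0(2,3) c[unfolded \<kappa>_def] Z1 cZ subspace_span
        \<sigma>1(1) Z\<sigma>1_ge D1 \<sigma>2(1) Z\<sigma>2 D2]
    have inv\<sigma>: "sqrt (zeta1 m \<delta>) * sqrt (?d / real m) = 1 / \<sigma>1" "sqrt (zeta2 m \<delta>) * sqrt (?d / real m) = 1 / \<sigma>2"
      unfolding z1 z2 \<sigma>1_def \<sigma>2_def by (simp_all add: real_sqrt_divide real_sqrt_mult)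
    have Z': "x * real_of_ereal r * real_of_ereal \<kappa> * zeta2 m \<delta> * (?d / real m) = x * c * ?\<rho> * Z" for x
      by (simp add: Z_def c r0(1))
    have "r > 0" "r \<noteq> \<infinity>"
      using \<rho> by (simp_all add: r0(1))
    then show ?thesis
      unfolding Z' mult.assoc[of _ "sqrt (zeta1 m \<delta>)"] mult.assoc[of _ "sqrt (zeta2 m \<delta>)"] inv\<sigma>
      using bounds by (simp add: ereal_le_divide_pos ereal_divide_le_pos r0(1) mult.commute)
  qed
  then have "A \<subseteq> {v \<in> space ?R.
             ereal ((1 - 0.625 * real_of_ereal r * real_of_ereal \<kappa> * zeta2 m \<delta> * (?d / real m))
                    * sqrt (zeta1 m \<delta>) * sqrt (?d / real m))
               \<le> advnorm f khat k x0 (span (v ` {..<m})) / r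
             \<and> advnorm f khat k x0 (span (v ` {..<m})) / r
               \<le> ereal ((1 + 2.25 * real_of_ereal r * real_of_ereal \<kappa> * zeta2 m \<delta> * (?d / real m))
                    * sqrt (zeta2 m \<delta>) * sqrt (?d / real m))}"
    unfolding A_def by blast
  ultimately show ?thesis
    by blast
qed

end
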